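(* For every integer $k \ge 2$, we have $$\frac{(k!)^2}{8e^2k^4} \le f'_{\mathrm{wES}}(k) \le f'_{\mathrm{sES}}(k) \le (1+o(1)) \cdot 16 k^8 (\ln k)^2 \cdot \binom{(k-1)^2+1}{k}^2 = (1+o(1)) \cdot \frac{8 k^{2k+7} e^{2k} (\ln k)^2}{\pi e^{5}},$$ and $$\frac{(k-1) \cdot (k-1)!}{2ek} \le n'_{\mathrm{wES}}(k) \le n'_{\mathrm{sES}}(k) \le (1+o(1)) \cdot 4k^7 \ln k \cdot \binom{(k-1)^2+1}{k} = (1+o(1)) \cdot \frac{2\sqrt{2} \cdot k^{k+6.5} \cdot e^k \ln k}{\sqrt{\pi} \cdot e^{2.5}},$$ where $f'_{\mathrm{wES}}(k)$ and $f'_{\mathrm{sES}}(k)$ (respectively $n'_{\mathrm{wES}}(k)$ and $n'_{\mathrm{sES}}(k)$) denote the minimum number of edges (respectively vertices) in a linear $k$-graph with the weak and the strong Erdős–Szekeres Property, and $o(1)$ denotes a quantity tending to $0$ as $k \to \infty$.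
   Context: A $k$-graph ($k$-uniform hypergraph) is a pair $\mathcal{H} = (V,\mathcal{E})$ where $V$ is a finite vertex set and $\mathcal{E}$ is a family of $k$-element subsets of $V$. It is linear if every two distinct edges intersect in at most one vertex. Two linear orders $<_1$ and $<_2$ on $V$ are monotonically consistent on an edge $e \in \mathcal{E}$ if the order induced by $<_2$ on $e$ is either equal to the order induced by $<_1$ on $e$ or is its reverse. A $k$-graph $\mathcal{H} = (V,\mathcal{E})$ has the weak Erdős–Szekeres Property if there exists a linear order $<_1$ on $V$ such that, for every linear order $<_2$ on $V$, there exists an edge $e \in \mathcal{E}$ on which $<_1$ and $<_2$ are monotonically consistent. It has the strong Erdős–Szekeres Property if for every linear order $<_1$ on $V$ and every linear order $<_2$ on $V$ there exists an edge $e \in \mathcal{E}$ on which $<_1$ and $<_2$ are monotonically consistent. Define $f'_{\mathrm{wES}}(k)$ (resp. $f'_{\mathrm{sES}}(k)$) as the minimum of $|\mathcal{E}|$, and $n'_{\mathrm{wES}}(k)$ (resp. $n'_{\mathrm{sES}}(k)$) as the minimum of $|V|$, over all linear $k$-graphs $\mathcal{H}=(V,\mathcal{E})$ with the weak (resp. strong) Erdős–Szekeres Property. Here $e \approx 2.718$ in the formulas is the base of the natural logarithm. The lower bounds hold for every integer $k \ge 2$; the upper bounds are asymptotic, with $o(1)\to 0$ as $k\to\infty$. *)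

theory Defs
  imports "HOL-Analysis.Analysis"
begin

definition kgraph :: "nat \<Rightarrow> 'a set \<Rightarrow> 'a set set \<Rightarrow> bool" where
  "kgraph k V \<E> \<longleftrightarrow> finite V \<and> (\<forall>e\<in>\<E>. e \<subseteq> V \<and> card e = k)"

definition linear_kgraph :: "nat \<Rightarrow> 'a set \<Rightarrow> 'a set set \<Rightarrow> bool" where
  "linear_kgraph k V \<E> \<longleftrightarrow> kgraph k V \<E> \<and> (\<forall>e\<in>\<E>. \<forall>e'\<in>\<E>. e \<noteq> e' \<longrightarrow> card (e \<inter> e') \<le> 1)"

text \<open>
  Linear orders on \<open>V\<close> are taken as reflexive relations contained in \<open>V \<times> V\<close>
  (\<^const>\<open>linear_order_on\<close>); the order induced on an edge \<open>e\<close> is \<open>Restr r e\<close>.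
\<close>

definition mono_consistent :: "'a rel \<Rightarrow> 'a rel \<Rightarrow> 'a set \<Rightarrow> bool" where
  "mono_consistent r\<^sub>1 r\<^sub>2 e \<longleftrightarrow> Restr r\<^sub>2 e = Restr r\<^sub>1 e \<or> Restr r\<^sub>2 e = (Restr r\<^sub>1 e)\<inverse>"

definition weak_ES :: "'a set \<Rightarrow> 'a set set \<Rightarrow> bool" where
  "weak_ES V \<E> \<longleftrightarrow>
    (\<exists>r\<^sub>1. linear_order_on V r\<^sub>1 \<and>
      (\<forall>r\<^sub>2. linear_order_on V r\<^sub>2 \<longrightarrow> (\<exists>e\<in>\<E>. mono_consistent r\<^sub>1 r\<^sub>2 e)))"

definition strong_ES :: "'a set \<Rightarrow> 'a set set \<Rightarrow> bool" where
  "strong_ES V \<E> \<longleftrightarrow>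
    (\<forall>r\<^sub>1 r\<^sub>2. linear_order_on V r\<^sub>1 \<longrightarrow> linear_order_on V r\<^sub>2 \<longrightarrow>
      (\<exists>e\<in>\<E>. mono_consistent r\<^sub>1 r\<^sub>2 e))"

text \<open>
  The minima range over \<open>k\<close>-graphs whose vertices are natural numbers. This loses nothing: by
  \<open>nat_copy\<close> below, every linear \<open>k\<close>-graph, over any vertex type, has a copy of this form.
  Note that \<^term>\<open>Inf {} = (0::nat)\<close>, whereas for \<open>k \<ge> 1\<close> all numbers in the sets below
  are positive (the Erdos-Szekeres properties force an edge); so a positive value means that the
  minimum is attained.
\<close>

definition f_wES :: "nat \<Rightarrow> nat" where
  "f_wES k = Inf {card \<E> |(V :: nat set) \<E>. linear_kgraph k V \<E> \<and> weak_ES V \<E>}"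

definition f_sES :: "nat \<Rightarrow> nat" where
  "f_sES k = Inf {card \<E> |(V :: nat set) \<E>. linear_kgraph k V \<E> \<and> strong_ES V \<E>}"

definition n_wES :: "nat \<Rightarrow> nat" where
  "n_wES k = Inf {card V |(V :: nat set) \<E>. linear_kgraph k V \<E> \<and> weak_ES V \<E>}"

definition n_sES :: "nat \<Rightarrow> nat" where
  "n_sES k = Inf {card V |(V :: nat set) \<E>. linear_kgraph k V \<E> \<and> strong_ES V \<E>}"

lemma linear_order_on_pullback:
  assumes "inj_on \<phi> V" "linear_order_on (\<phi> ` V) r"
  shows "linear_order_on V (Restr (inv_image r \<phi>) V)"
proof -
  have r: "refl_on (\<phi> ` V) r" "trans r" "antisym r" "total_on (\<phi> ` V) r"
    using assms(2) by (auto simp: order_on_defs)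
  have "refl_on V (Restr (inv_image r \<phi>) V)"
    using r(1) by (auto simp: refl_on_def)
  moreover have "trans (Restr (inv_image r \<phi>) V)"
    using r(2) by (auto simp: trans_def)
  moreover have "antisym (Restr (inv_image r \<phi>) V)"
    using r(3) assms(1) by (auto simp: antisym_def inj_on_def)
  moreover have "total_on V (Restr (inv_image r \<phi>) V)"
    using r(4) assms(1) by (auto simp: total_on_def inj_on_def)
  ultimately show ?thesis by (auto simp: order_on_defs)
qed

lemma mono_consistent_image:
  assumes "e \<subseteq> V" "mono_consistent (Restr (inv_image r\<^sub>1 \<phi>) V) (Restr (inv_image r\<^sub>2 \<phi>) V) e"
  shows "mono_consistent r\<^sub>1 r\<^sub>2 (\<phi> ` e)"
proof -
  have *: "(x, y) \<in> Restr (Restr (inv_image r \<phi>) V) e \<longleftrightarrow> x \<in> e \<and> y \<in> e \<and> (\<phi> x, \<phi> y) \<in> r" for x y r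
    using assms(1) by auto
  from assms(2) show ?thesis
    unfolding mono_consistent_def
  proof (elim disjE)
    assume "Restr (Restr (inv_image r\<^sub>2 \<phi>) V) e = Restr (Restr (inv_image r\<^sub>1 \<phi>) V) e"
    then have "\<forall>x\<in>e. \<forall>y\<in>e. (\<phi> x, \<phi> y) \<in> r\<^sub>2 \<longleftrightarrow> (\<phi> x, \<phi> y) \<in> r\<^sub>1"
      using * by (metis (no_types))
    then show "Restr r\<^sub>2 (\<phi> ` e) = Restr r\<^sub>1 (\<phi> ` e) \<or> Restr r\<^sub>2 (\<phi> ` e) = (Restr r\<^sub>1 (\<phi> ` e))\<inverse>"
      by auto
  next
    assume "Restr (Restr (inv_image r\<^sub>2 \<phi>) V) e = (Restr (Restr (inv_image r\<^sub>1 \<phi>) V) e)\<inverse>"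
    then have "\<forall>x\<in>e. \<forall>y\<in>e. (\<phi> x, \<phi> y) \<in> r\<^sub>2 \<longleftrightarrow> (\<phi> y, \<phi> x) \<in> r\<^sub>1"
      using * by (metis (no_types) converse_iff)
    then show "Restr r\<^sub>2 (\<phi> ` e) = Restr r\<^sub>1 (\<phi> ` e) \<or> Restr r\<^sub>2 (\<phi> ` e) = (Restr r\<^sub>1 (\<phi> ` e))\<inverse>"
      by auto
  qed
qed

lemma strong_ES_image:
  assumes "inj_on \<phi> V" "\<And>e. e \<in> \<E> \<Longrightarrow> e \<subseteq> V" "strong_ES V \<E>"
  shows "strong_ES (\<phi> ` V) ((`) \<phi> ` \<E>)"
  unfolding strong_ES_def
proof (intro allI impI)
  fix r\<^sub>1 r\<^sub>2 assume "linear_order_on (\<phi> ` V) r\<^sub>1" "linear_order_on (\<phi> ` V) r\<^sub>2"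
  then obtain e where "e \<in> \<E>"
    "mono_consistent (Restr (inv_image r\<^sub>1 \<phi>) V) (Restr (inv_image r\<^sub>2 \<phi>) V) e"
    using assms(3) linear_order_on_pullback[OF assms(1)] unfolding strong_ES_def by meson
  then show "\<exists>e\<in>(`) \<phi> ` \<E>. mono_consistent r\<^sub>1 r\<^sub>2 e"
    using mono_consistent_image assms(2) by blast
qed

lemma weak_ES_image:
  assumes "inj_on \<phi> V" "\<And>e. e \<in> \<E> \<Longrightarrow> e \<subseteq> V" "weak_ES V \<E>"
  shows "weak_ES (\<phi> ` V) ((`) \<phi> ` \<E>)"
proof -
  obtain r where r: "linear_order_on V r"
    "\<And>s. linear_order_on V s \<Longrightarrow> \<exists>e\<in>\<E>. mono_consistent r s e"
    using assms(3) unfolding weak_ES_def by blast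
  define \<psi> where "\<psi> = the_inv_into V \<phi>"
  have \<psi>: "\<And>x. x \<in> V \<Longrightarrow> \<psi> (\<phi> x) = x"
    using assms(1) by (simp add: \<psi>_def the_inv_into_f_f)
  define r' where "r' = Restr (inv_image r \<psi>) (\<phi> ` V)"
  have "\<psi> ` \<phi> ` V = V" using \<psi> by force
  moreover have "inj_on \<psi> (\<phi> ` V)" using \<psi> by (auto simp: inj_on_def)
  ultimately have lin: "linear_order_on (\<phi> ` V) r'"
    unfolding r'_def using linear_order_on_pullback[of \<psi> "\<phi> ` V" r] r(1) by simp
  have "r \<subseteq> V \<times> V" using r(1) by (auto simp: order_on_defs)
  then have r'_pull: "Restr (inv_image r' \<phi>) V = r"
    using \<psi> by (auto simp: r'_def)
  have "\<exists>e\<in>(`) \<phi> ` \<E>. mono_consistent r' s e" if "linear_order_on (\<phi> ` V) s" for s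
    using r(2)[OF linear_order_on_pullback[OF assms(1) that]] r'_pull
      mono_consistent_image[of _ V r' \<phi> s] assms(2) by auto
  with lin show ?thesis unfolding weak_ES_def by blast
qed

lemma nat_copy:
  fixes V :: "'a set"
  assumes "linear_kgraph k V \<E>"
  obtains V' :: "nat set" and \<E>' where "linear_kgraph k V' \<E>'" "card V' = card V" "card \<E>' = card \<E>"
    "weak_ES V \<E> \<Longrightarrow> weak_ES V' \<E>'" "strong_ES V \<E> \<Longrightarrow> strong_ES V' \<E>'"
proof -
  have fin: "finite V" and sub: "\<And>e. e \<in> \<E> \<Longrightarrow> e \<subseteq> V" and ck: "\<And>e. e \<in> \<E> \<Longrightarrow> card e = k"
    and lin: "\<And>e e'. e \<in> \<E> \<Longrightarrow> e' \<in> \<E> \<Longrightarrow> e \<noteq> e' \<Longrightarrow> card (e \<inter> e') \<le> 1"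
    using assms by (auto simp: linear_kgraph_def kgraph_def)
  obtain \<phi> :: "'a \<Rightarrow> nat" where inj: "inj_on \<phi> V"
    using finite_imp_inj_to_nat_seg[OF fin] by blast
  have c: "card (\<phi> ` e) = card e" if "e \<subseteq> V" for e
    using inj that by (meson card_image inj_on_subset)
  have "card (\<phi> ` e \<inter> \<phi> ` e') \<le> 1" if "e \<in> \<E>" "e' \<in> \<E>" "\<phi> ` e \<noteq> \<phi> ` e'" for e e'
  proof -
    have "\<phi> ` e \<inter> \<phi> ` e' = \<phi> ` (e \<inter> e')"
      using inj_on_image_Int[OF inj sub[OF that(1)] sub[OF that(2)]] by simp
    moreover have "card (\<phi> ` (e \<inter> e')) = card (e \<inter> e')" using sub that by (intro c) blast
    moreover have "card (e \<inter> e') \<le> 1" using lin[OF that(1,2)] that(3) by blast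
    ultimately show ?thesis by simp
  qed
  moreover have "\<phi> ` e \<subseteq> \<phi> ` V" "card (\<phi> ` e) = k" if "e \<in> \<E>" for e
    using sub[OF that] ck[OF that] c[OF sub[OF that]] by (simp_all add: image_mono)
  ultimately have "linear_kgraph k (\<phi> ` V) ((`) \<phi> ` \<E>)"
    using fin unfolding linear_kgraph_def kgraph_def by blast
  moreover have "inj_on ((`) \<phi>) \<E>"
    using inj_on_image_eq_iff[OF inj] sub by (auto simp: inj_on_def)
  then have "card ((`) \<phi> ` \<E>) = card \<E>" by (rule card_image)
  ultimately show ?thesis
    using that c[of V] weak_ES_image[OF inj sub] strong_ES_image[OF inj sub] by blast
qed

end

theory Submission
  imports Defs "HOL-Combinatorics.Multiset_Permutations" "HOL-Real_Asymp.Real_Asymp"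
begin

text \<open>
  Lower bounds. In place of the Local Lemma, the linear orders of \<open>S\<close> that are consistent with
  \<open>r\<^sub>1\<close> on no edge are counted while \<open>S\<close> grows vertex by vertex: if all degrees are at most
  \<open>(k - 1)! / (2 e)\<close>, the proportion of such orders drops at most by the factor \<open>1 - 1 / k\<close> in each
  step, hence stays positive. So the weak property forces a vertex of larger degree, and in a linear
  \<open>k\<close>-graph this vertex has many neighbours.

  Upper bounds. Put \<open>N = (k - 1)\<^sup>2 + 1\<close>. The lines \<open>y = a x + b\<close> modulo \<open>s N\<close> with slope \<open>a < s\<close>
  over \<open>x < N\<close> form a linear \<open>N\<close>-graph with \<open>s\<^sup>2 N\<close> edges on \<open>s N\<^sup>2\<close> vertices. By the
  Erdos-Szekeres theorem, for every pair of orders a random \<open>k\<close>-subset of a line is consistent with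
  probability at least \<open>1 / (N choose k)\<close>, so choosing one \<open>k\<close>-subset of each line independently
  succeeds for all pairs of orders as soon as \<open>s > 2 N (N choose k) ln (N\<^sup>2 s)\<close>; for large \<open>k\<close>,
  \<open>s = \<lfloor>4 k\<^sup>3 ln k (N choose k)\<rfloor>\<close> is enough.
\<close>

section \<open>Orders avoiding sparse constraints\<close>

text \<open>Earlier entries are smaller. With this encoding, restricting an order to an edge is
  filtering, and counting orders is counting \<open>permutations_of_set\<close>.\<close>

primrec list_order :: "'a list \<Rightarrow> 'a rel" where
  "list_order [] = {}"
| "list_order (x # xs) = insert (x, x) ({x} \<times> set xs) \<union> list_order xs"

lemma list_order_subset: "list_order xs \<subseteq> set xs \<times> set xs"
  by (induction xs) auto

lemma linear_order_list_order:
  assumes "distinct xs"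
  shows "linear_order_on (set xs) (list_order xs)"
  using assms
proof (induction xs)
  case Nil
  then show ?case by (simp add: linear_order_on_def partial_order_on_def preorder_on_def refl_on_def
      trans_def antisym_def total_on_def)
next
  case (Cons x xs)
  then have IH: "refl_on (set xs) (list_order xs)" "trans (list_order xs)" "antisym (list_order xs)"
    "total_on (set xs) (list_order xs)" and x: "x \<notin> set xs"
    by (auto simp: order_on_defs)
  have sub: "a \<in> set xs" "b \<in> set xs" if "(a, b) \<in> list_order xs" for a b
    using list_order_subset[of xs] that by auto
  have "list_order (x # xs) \<subseteq> set (x # xs) \<times> set (x # xs)"
    by (rule list_order_subset)
  moreover have "refl_on (set (x # xs)) (list_order (x # xs))"
    using IH(1) sub by (auto simp: refl_on_def)
  moreover have "trans (list_order (x # xs))"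
  proof (rule transI)
    fix a b c assume "(a, b) \<in> list_order (x # xs)" "(b, c) \<in> list_order (x # xs)"
    then show "(a, c) \<in> list_order (x # xs)"
      using transD[OF IH(2)] sub x by auto
  qed
  moreover have "antisym (list_order (x # xs))"
    using antisymD[OF IH(3)] sub x by (auto intro!: antisymI)
  moreover have "total_on (set (x # xs)) (list_order (x # xs))"
    using IH(4) by (auto simp: total_on_def)
  ultimately show ?case by (simp only: order_on_defs)
qed

lemma Restr_list_order: "Restr (list_order xs) A = list_order (filter (\<lambda>x. x \<in> A) xs)"
  by (induction xs) auto

text \<open>The head is recovered as the least element and the tail by restricting to the other
  elements. Hence forbidding one given relation on an edge forbids at most one list.\<close>

lemma list_order_inj:
  assumes "distinct xs" "distinct ys" "set xs = set ys" "list_order xs = list_order ys"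
  shows "xs = ys"
  using assms
proof (induction xs arbitrary: ys)
  case Nil
  then show ?case by simp
next
  case (Cons x xs)
  then obtain y ys' where ys: "ys = y # ys'" by (cases ys) auto
  have sub: "a \<in> set ys'" "b \<in> set ys'" if "(a, b) \<in> list_order ys'" for a b
    using list_order_subset[of ys'] that by auto
  have "y \<in> set (x # xs)" using Cons.prems(3) ys by simp
  then have "(x, y) \<in> list_order (x # xs)" by auto
  then have "(x, y) \<in> list_order (y # ys')" using Cons.prems(4) ys by metis
  then have xy: "x = y" using sub Cons.prems(2) ys by auto
  then have s: "set xs = set ys'" using Cons.prems(1-3) ys by auto
  have "list_order xs = Restr (list_order (x # xs)) (set xs)"
    using list_order_subset[of xs] Cons.prems(1) by auto
  also have "\<dots> = Restr (list_order (y # ys')) (set ys')"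
    using Cons.prems(4) ys s by simp
  also have "\<dots> = list_order ys'"
    using list_order_subset[of ys'] Cons.prems(2) ys by auto
  finally show ?case using Cons.IH[of ys'] Cons.prems ys xy s by simp
qed

section \<open>Counting the permutations that avoid forbidden edge patterns\<close>

text \<open>\<open>F e\<close> is the set of forbidden arrangements of \<open>e\<close>. Only edges
  lying completely in \<open>S\<close> impose a constraint, so that \<open>S\<close> can grow one
  vertex at a time.\<close>

definition avoiding :: "'a set set \<Rightarrow> ('a set \<Rightarrow> 'a list set) \<Rightarrow> 'a set \<Rightarrow> 'a list set" where
  "avoiding \<E> F S = {xs \<in> permutations_of_set S. \<forall>e\<in>\<E>. e \<subseteq> S \<longrightarrow> filter (\<lambda>x. x \<in> e) xs \<notin> F e}"

text \<open>The probability that a uniformly random permutation of \<open>S\<close> is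
  avoiding.\<close>

definition avoiding_density :: "'a set set \<Rightarrow> ('a set \<Rightarrow> 'a list set) \<Rightarrow> 'a set \<Rightarrow> real" where
  "avoiding_density \<E> F S = card (avoiding \<E> F S) / fact (card S)"

lemma finite_avoiding [simp]: "finite (avoiding \<E> F S)"
  by (rule finite_subset[OF _ finite_permutations_of_set[of S]]) (auto simp: avoiding_def)

text \<open>\<open>1 - 1 / k\<close> is the inverse of \<open>1 + 1 / (k - 1)\<close>, whose power
  is at most \<open>exp 1\<close>. This is the source of the constant e in the lower bounds: it is
  the loss from adding \<open>k - 1\<close> vertices.\<close>

lemma one_minus_inverse_power_ge:
  assumes "k \<ge> 2"
  shows "(1 - 1 / real k) ^ (k - 1) \<ge> 1 / exp 1"
proof -
  define m where "m = k - 1"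
  have m: "m \<ge> 1" "real k = real m + 1" using assms by (auto simp: m_def)
  have "(1 + 1 / real m) ^ m \<le> exp (1 / real m) ^ m"
    by (intro power_mono) (auto simp: add.commute)
  also have "\<dots> = exp 1" using m by (simp flip: exp_of_nat_mult)
  finally have *: "(1 + 1 / real m) ^ m \<le> exp 1" .
  have "1 - 1 / real k = inverse (1 + 1 / real m)" using m by (simp add: field_simps)
  then have "(1 - 1 / real k) ^ m = inverse ((1 + 1 / real m) ^ m)" by (simp add: power_inverse)
  also have "\<dots> \<ge> inverse (exp 1)"
    using * m by (intro le_imp_inverse_le) (auto intro!: zero_less_power add_pos_nonneg)
  finally show ?thesis by (simp add: m_def inverse_eq_divide)
qed

text \<open>Iterates the one-vertex estimate. The estimate is assumed only for sets inside
  \<open>T \<union> W\<close>, which is what the induction below can supply.\<close>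

lemma avoiding_density_Un:
  assumes "\<alpha> \<ge> 0" "finite W" "T \<inter> W = {}"
    and "\<And>S v. \<lbrakk>S \<subseteq> T \<union> W; v \<in> T \<union> W; v \<notin> S\<rbrakk> \<Longrightarrow>
      \<alpha> * avoiding_density \<E> F S \<le> avoiding_density \<E> F (insert v S)"
  shows "\<alpha> ^ card W * avoiding_density \<E> F T \<le> avoiding_density \<E> F (T \<union> W)"
  using assms(2-)
proof (induction W)
  case (insert w W)
  have "\<alpha> ^ card W * avoiding_density \<E> F T \<le> avoiding_density \<E> F (T \<union> W)"
    using insert.prems by (intro insert.IH) auto
  then have "\<alpha> ^ card (insert w W) * avoiding_density \<E> F T \<le> \<alpha> * avoiding_density \<E> F (T \<union> W)"
    using insert.hyps assms(1) by (simp add: mult_left_mono mult.assoc)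
  also have "\<dots> \<le> avoiding_density \<E> F (insert w (T \<union> W))"
    using insert by (intro insert.prems) auto
  finally show ?case by simp
qed simp

text \<open>Insert \<open>v\<close> into the avoiding permutations of \<open>S\<close> in all
  positions. A result can fail only at an edge \<open>e\<close> through \<open>v\<close>, and then
  it shuffles one of at most two forbidden lists with an avoiding permutation of
  \<open>insert v S - e\<close>. By induction the density of that smaller set is at most
  \<open>exp 1\<close> times that of \<open>S\<close>, so each edge costs at most the proportion
  \<open>2 * exp 1 / fact k\<close>, and the degree bound limits the total to
  \<open>1 / k\<close>.\<close>

lemma avoiding_density_insert:
  fixes F :: "'a set \<Rightarrow> 'a list set"
  assumes k: "k \<ge> 2" and V: "finite V"
    and \<E>: "\<And>e. e \<in> \<E> \<Longrightarrow> e \<subseteq> V" "\<And>e. e \<in> \<E> \<Longrightarrow> card e = k"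
    and F: "\<And>e. e \<in> \<E> \<Longrightarrow> F e \<subseteq> permutations_of_set e" "\<And>e. e \<in> \<E> \<Longrightarrow> card (F e) \<le> 2"
    and deg: "\<And>v. v \<in> V \<Longrightarrow> 2 * exp 1 * real (card {e \<in> \<E>. v \<in> e}) \<le> fact (k - 1)"
    and S: "S \<subseteq> V" and v: "v \<in> V" "v \<notin> S"
  shows "(1 - 1 / real k) * avoiding_density \<E> F S \<le> avoiding_density \<E> F (insert v S)"
  using S v
proof (induction "card S" arbitrary: S v rule: less_induct)
  case less
  define h where "h = avoiding_density \<E> F"
  define m where "m = card (insert v S)"
  have fin: "finite S" using less.prems(1) V finite_subset by blast
  have m: "m = Suc (card S)" using fin less.prems by (simp add: m_def)
  have h0: "h T \<ge> 0" for T by (simp add: h_def avoiding_density_def)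
  have fin\<E>: "finite \<E>" using \<E>(1) V by (meson finite_Pow_iff finite_subset PowI subsetI)
  \<comment> \<open>\<open>shuffles [v] ys\<close> consists of the insertions of \<open>v\<close>
    into \<open>ys\<close>. Deleting \<open>v\<close> recovers \<open>ys\<close>, so nothing is
    counted twice and \<open>X\<close> has exactly \<open>m\<close> members for each
    \<open>ys\<close>.\<close>
  define X where "X = (\<Union>ys\<in>avoiding \<E> F S. shuffles [v] ys)"
  \<comment> \<open>\<open>Y e\<close> covers the insertions that fail at \<open>e\<close>; it may
    contain further permutations, which only weakens the estimate.\<close>
  define Y where "Y = (\<lambda>e. \<Union>as\<in>F e. \<Union>bs\<in>avoiding \<E> F (insert v S - e). shuffles as bs)"
  define D where "D = {e \<in> \<E>. v \<in> e \<and> e \<subseteq> insert v S}"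
  have ys: "v \<notin> set ys" "distinct ys" "length ys = card S" "set ys = S"
    if "ys \<in> avoiding \<E> F S" for ys
    using that less.prems by (auto simp: avoiding_def permutations_of_set_def distinct_card)
  have del_v: "filter (\<lambda>x. x \<noteq> v) xs = ys" if "ys \<in> avoiding \<E> F S" "xs \<in> shuffles [v] ys" for xs ys
    using filter_shuffles_disjoint1(2)[of "[v]" ys xs] ys[OF that(1)] that(2) by simp
  have perm: "xs \<in> permutations_of_set (insert v S)"
    if "ys \<in> avoiding \<E> F S" "xs \<in> shuffles [v] ys" for xs ys
    using distinct_disjoint_shuffles[of "[v]" ys xs] set_shuffles[OF that(2)] ys[OF that(1)] that
    by (auto intro!: permutations_of_setI)
  have "card X = (\<Sum>ys\<in>avoiding \<E> F S. card (shuffles [v] ys))"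
    unfolding X_def using del_v by (intro card_UN_disjoint) (simp, simp, blast)
  also have "\<dots> = (\<Sum>ys\<in>avoiding \<E> F S. m)"
  proof (rule sum.cong)
    fix ys assume "ys \<in> avoiding \<E> F S"
    then show "card (shuffles [v] ys) = m"
      using ys[of ys] m by (subst card_disjoint_shuffles) auto
  qed simp
  finally have cardX: "card X = m * card (avoiding \<E> F S)" by simp
  have sub: "X \<subseteq> avoiding \<E> F (insert v S) \<union> (\<Union>e\<in>D. Y e)"
  proof
    fix xs assume "xs \<in> X"
    then obtain ys where xs: "ys \<in> avoiding \<E> F S" "xs \<in> shuffles [v] ys"
      by (auto simp: X_def)
    \<comment> \<open>Edges inside \<open>S\<close> do not see \<open>v\<close>, so they stay
      satisfied after the insertion.\<close>
    have av_S: "filter (\<lambda>x. x \<in> e) xs \<notin> F e" if "e \<in> \<E>" "e \<subseteq> S" for e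
    proof -
      have "filter (\<lambda>x. x \<in> e) ys \<notin> F e"
        using xs(1) that by (auto simp: avoiding_def)
      moreover have "filter (\<lambda>x. x \<in> e) ys = filter (\<lambda>x. x \<in> e) xs"
        unfolding del_v[OF xs, symmetric] filter_filter
        by (rule filter_cong) (use that less.prems in auto)
      ultimately show ?thesis by simp
    qed
    show "xs \<in> avoiding \<E> F (insert v S) \<union> (\<Union>e\<in>D. Y e)"
    proof (cases "xs \<in> avoiding \<E> F (insert v S)")
      case False
      then obtain e where e: "e \<in> \<E>" "e \<subseteq> insert v S" "filter (\<lambda>x. x \<in> e) xs \<in> F e"
        using perm[OF xs] by (auto simp: avoiding_def)
      then have "v \<in> e" using av_S[of e] by auto
      then have "e \<in> D" using e by (simp add: D_def)
      have "filter (\<lambda>x. x \<notin> e) xs \<in> permutations_of_set (insert v S - e)"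
        using perm[OF xs] by (auto simp: permutations_of_set_def)
      moreover have "filter (\<lambda>x. x \<in> e') (filter (\<lambda>x. x \<notin> e) xs) \<notin> F e'"
        if "e' \<in> \<E>" "e' \<subseteq> insert v S - e" for e'
      proof -
        have "filter (\<lambda>x. x \<in> e') (filter (\<lambda>x. x \<notin> e) xs) = filter (\<lambda>x. x \<in> e') xs"
          unfolding filter_filter by (rule filter_cong) (use that in auto)
        then show ?thesis using av_S[of e'] that \<open>v \<in> e\<close> by auto
      qed
      ultimately have "filter (\<lambda>x. x \<notin> e) xs \<in> avoiding \<E> F (insert v S - e)"
        by (simp add: avoiding_def)
      then have "xs \<in> Y e"
        unfolding Y_def using partition_in_shuffles[of xs "\<lambda>x. x \<in> e"] e(3) by blast
      then show ?thesis using \<open>e \<in> D\<close> by blast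
    qed simp
  qed
  \<comment> \<open>The permitted total loss \<open>1 / k\<close> is divided evenly among the edges
    in \<open>D\<close>.\<close>
  have cardY: "real (card (Y e)) \<le> fact m * (1 / (real k * card D)) * h S" if e: "e \<in> D" for e
  proof -
    have e': "e \<in> \<E>" "v \<in> e" "e \<subseteq> insert v S" using e by (auto simp: D_def)
    have fine: "finite e" using e'(3) fin finite_subset by auto
    have ck: "card e = k" using \<E>(2) e' by blast
    have km: "k \<le> m" using card_mono[OF _ e'(3)] fin ck by (simp add: m_def)
    define T where "T = insert v S - e"
    have T: "card T = m - k" by (simp only: T_def m_def card_Diff_subset[OF fine e'(3)] ck)
    have disj: "card (shuffles as bs) \<le> m choose k"
      if "as \<in> F e" "bs \<in> avoiding \<E> F T" for as bs
    proof -
      have "set as = e" "length as = k"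
        using F(1)[OF e'(1)] that(1) ck by (auto simp: permutations_of_set_def dest!: distinct_card)
      moreover have "set bs = T" "length bs = m - k"
        using that(2) T by (auto simp: avoiding_def permutations_of_set_def dest!: distinct_card)
      moreover have "e \<inter> T = {}" by (auto simp: T_def)
      ultimately show ?thesis using km by (subst card_disjoint_shuffles) auto
    qed
    have finF: "finite (F e)" using F(1)[OF e'(1)] finite_permutations_of_set finite_subset by blast
    have "card (Y e) \<le> (\<Sum>as\<in>F e. card (\<Union>bs\<in>avoiding \<E> F T. shuffles as bs))"
      unfolding Y_def T_def[symmetric] by (rule card_UN_le[OF finF])
    also have "\<dots> \<le> (\<Sum>as\<in>F e. \<Sum>bs\<in>avoiding \<E> F T. card (shuffles as bs))"
      by (intro sum_mono card_UN_le) simp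
    also have "\<dots> \<le> (\<Sum>as\<in>F e. \<Sum>bs\<in>avoiding \<E> F T. m choose k)"
      by (intro sum_mono disj)
    also have "\<dots> = card (F e) * (card (avoiding \<E> F T) * (m choose k))" by simp
    also have "\<dots> \<le> 2 * (card (avoiding \<E> F T) * (m choose k))"
      using F(2)[OF e'(1)] by (rule mult_right_mono) simp
    finally have "real (card (Y e)) \<le> real (2 * (card (avoiding \<E> F T) * (m choose k)))"
      by (rule of_nat_mono)
    also have "\<dots> = 2 * h T * fact (m - k) * (fact m / (fact k * fact (m - k)))"
      using binomial_fact[OF km, where ?'a = real] T by (simp add: h_def avoiding_density_def)
    also have "\<dots> = fact m * (2 * h T / fact k)" by simp
    finally have Y1: "real (card (Y e)) \<le> fact m * (2 * h T / fact k)" .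
    \<comment> \<open>Adding the \<open>k - 1\<close> vertices of \<open>e\<close> other than
      \<open>v\<close> one by one leads from \<open>T\<close> to \<open>S\<close>. Each step starts
      from a proper subset of \<open>S\<close>, so the induction hypothesis applies to it.\<close>
    have S_eq: "S = T \<union> (e - {v})" using e' less.prems by (auto simp: T_def)
    have cW: "card (e - {v}) = k - 1" using e' ck fine by simp
    have "(1 - 1 / real k) ^ card (e - {v}) * avoiding_density \<E> F T \<le> avoiding_density \<E> F (T \<union> (e - {v}))"
    proof (rule avoiding_density_Un)
      fix S' v' assume A: "S' \<subseteq> T \<union> (e - {v})" "v' \<in> T \<union> (e - {v})" "v' \<notin> S'"
      then have "S' \<subset> S" using S_eq by blast
      then have "card S' < card S" using fin by (rule psubset_card_mono[rotated])
      then show "(1 - 1 / real k) * avoiding_density \<E> F S' \<le> avoiding_density \<E> F (insert v' S')"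
        using less.hyps[of S' v'] A S_eq less.prems by blast
    qed (use k fine in \<open>auto simp: T_def\<close>)
    then have "(1 - 1 / real k) ^ (k - 1) * h T \<le> h S"
      using S_eq cW by (simp add: h_def)
    moreover have "1 / exp 1 * h T \<le> (1 - 1 / real k) ^ (k - 1) * h T"
      using one_minus_inverse_power_ge[OF k] h0 by (rule mult_right_mono)
    ultimately have "1 / exp 1 * h T \<le> h S" by (rule order_trans[rotated])
    then have hT: "h T \<le> exp 1 * h S" by (simp add: field_simps)
    have "card D \<le> card {e \<in> \<E>. v \<in> e}" using fin\<E> by (intro card_mono) (auto simp: D_def)
    then have "2 * exp 1 * real (card D) \<le> 2 * exp 1 * real (card {e \<in> \<E>. v \<in> e})"
      by simp
    also have "\<dots> \<le> fact (k - 1)" using deg less.prems by blast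
    finally have D: "2 * exp 1 * real (card D) \<le> fact (k - 1)" .
    have D0: "card D > 0" using e fin\<E> by (auto simp: card_gt_0_iff D_def)
    have fk: "fact k = real k * fact (k - 1)" using k by (simp add: fact_reduce)
    have "2 * h T / fact k \<le> 2 * (exp 1 * h S) / fact k"
      using hT by (intro divide_right_mono) auto
    also have "\<dots> = (2 * exp 1 / fact k) * h S" by simp
    also have "2 * exp 1 / fact k \<le> 1 / (real k * card D)"
      using D D0 k by (simp add: fk field_simps)
    then have "(2 * exp 1 / fact k) * h S \<le> 1 / (real k * card D) * h S"
      using h0 by (rule mult_right_mono)
    finally have "2 * h T / fact k \<le> 1 / (real k * card D) * h S" .
    then have "fact m * (2 * h T / fact k) \<le> fact m * (1 / (real k * card D) * h S)"
      by (intro mult_left_mono) auto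
    then show ?thesis using Y1 by (simp add: mult.assoc)
  qed
  have finD: "finite D" using fin\<E> by (simp add: D_def)
  have finY: "finite (Y e)" if "e \<in> D" for e
  proof -
    have "finite (F e)" using F(1)[of e] that finite_permutations_of_set finite_subset
      by (metis (no_types, lifting) D_def mem_Collect_eq)
    then show ?thesis by (simp add: Y_def)
  qed
  have "real (\<Sum>e\<in>D. card (Y e)) \<le> (\<Sum>e\<in>D. fact m * (1 / (real k * card D)) * h S)"
    unfolding of_nat_sum by (rule sum_mono) (rule cardY)
  \<comment> \<open>If \<open>D\<close> is empty the sum is 0; otherwise the size of
    \<open>D\<close> cancels.\<close>
  also have "\<dots> \<le> fact m * (1 / real k) * h S"
    using h0[of S] by (cases "card D = 0") auto
  finally have sumY: "real (\<Sum>e\<in>D. card (Y e)) \<le> fact m * (1 / real k) * h S" .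
  have "card X \<le> card (avoiding \<E> F (insert v S) \<union> (\<Union>e\<in>D. Y e))"
    using sub finD finY by (intro card_mono) auto
  also have "\<dots> \<le> card (avoiding \<E> F (insert v S)) + card (\<Union>e\<in>D. Y e)"
    by (rule card_Un_le)
  also have "\<dots> \<le> card (avoiding \<E> F (insert v S)) + (\<Sum>e\<in>D. card (Y e))"
    using card_UN_le[OF finD] by simp
  finally have "real (m * card (avoiding \<E> F S)) \<le>
      real (card (avoiding \<E> F (insert v S)) + (\<Sum>e\<in>D. card (Y e)))"
    unfolding cardX by (rule of_nat_mono)
  then have "real (m * card (avoiding \<E> F S)) \<le>
      real (card (avoiding \<E> F (insert v S))) + real (\<Sum>e\<in>D. card (Y e))"
    by (simp only: of_nat_add)
  moreover have "real (m * card (avoiding \<E> F S)) = fact m * h S"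
    by (simp add: h_def avoiding_density_def m algebra_simps)
  moreover have "real (card (avoiding \<E> F (insert v S))) = fact m * h (insert v S)"
    by (simp add: h_def avoiding_density_def m_def)
  ultimately have "fact m * h S \<le> fact m * h (insert v S) + fact m * (1 / real k) * h S"
    using sumY by linarith
  then have "fact m * ((1 - 1 / real k) * h S) \<le> fact m * h (insert v S)"
    by (simp add: algebra_simps)
  then show ?case unfolding h_def by simp
qed

text \<open>The empty set has density 1, because no edge is empty, and each added vertex costs at
  most a positive factor.\<close>

lemma avoiding_nonempty:
  fixes F :: "'a set \<Rightarrow> 'a list set"
  assumes k: "k \<ge> 2" and V: "finite V"
    and \<E>: "\<And>e. e \<in> \<E> \<Longrightarrow> e \<subseteq> V" "\<And>e. e \<in> \<E> \<Longrightarrow> card e = k"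
    and F: "\<And>e. e \<in> \<E> \<Longrightarrow> F e \<subseteq> permutations_of_set e" "\<And>e. e \<in> \<E> \<Longrightarrow> card (F e) \<le> 2"
    and deg: "\<And>v. v \<in> V \<Longrightarrow> 2 * exp 1 * real (card {e \<in> \<E>. v \<in> e}) \<le> fact (k - 1)"
  shows "avoiding \<E> F V \<noteq> {}"
proof -
  have "e \<noteq> {}" if "e \<in> \<E>" for e using \<E>(2)[OF that] k by auto
  then have "avoiding \<E> F {} = {[]}" by (auto simp: avoiding_def)
  then have "avoiding_density \<E> F {} = 1" by (simp add: avoiding_density_def)
  moreover have "(1 - 1 / real k) ^ card V * avoiding_density \<E> F {} \<le> avoiding_density \<E> F ({} \<union> V)"
    by (rule avoiding_density_Un)
      (use avoiding_density_insert[OF k V \<E> F deg] k V in auto)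
  moreover have "(1 - 1 / real k) ^ card V > 0" using k by (intro zero_less_power) simp
  ultimately have "avoiding_density \<E> F V > 0" by simp
  then show ?thesis by (auto simp: avoiding_density_def)
qed

text \<open>For each edge, forbid the lists that induce the order of \<open>r\<close> or its
  reverse. By \<open>list_order_inj\<close> there are at most two of them, and an avoiding
  permutation of \<open>V\<close> is the desired order.\<close>

lemma exists_inconsistent_order:
  fixes V :: "'a set" and r :: "'a rel"
  assumes k: "k \<ge> 2" and \<E>: "kgraph k V \<E>"
    and deg: "\<And>v. v \<in> V \<Longrightarrow> 2 * exp 1 * real (card {e \<in> \<E>. v \<in> e}) \<le> fact (k - 1)"
  shows "\<exists>r'. linear_order_on V r' \<and> (\<forall>e\<in>\<E>. \<not> mono_consistent r r' e)"
proof -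
  define P :: "'a set \<Rightarrow> 'a rel \<Rightarrow> 'a list set" where "P = (\<lambda>e R. {xs \<in> permutations_of_set e. list_order xs = R})"
  define F where "F = (\<lambda>e. P e (Restr r e) \<union> P e ((Restr r e)\<inverse>))"
  have "card (P e R) \<le> 1" for e :: "'a set" and R
    unfolding One_nat_def
    by (subst card_le_Suc0_iff_eq)
      (auto simp: P_def permutations_of_set_def intro: list_order_inj
        finite_subset[OF _ finite_permutations_of_set[of e]])
  then have "card (F e) \<le> 2" for e
    unfolding F_def using card_Un_le[of "P e (Restr r e)" "P e ((Restr r e)\<inverse>)"]
    by (metis add_mono one_add_one order_trans)
  moreover have "F e \<subseteq> permutations_of_set e" for e by (auto simp: F_def P_def)
  ultimately obtain xs where xs: "xs \<in> avoiding \<E> F V"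
    using avoiding_nonempty[OF k, of V \<E> F] \<E> deg by (auto simp: kgraph_def)
  then have xs': "distinct xs" "set xs = V" by (auto simp: avoiding_def permutations_of_set_def)
  have "\<not> mono_consistent r (list_order xs) e" if "e \<in> \<E>" for e
  proof
    assume "mono_consistent r (list_order xs) e"
    then have "list_order (filter (\<lambda>x. x \<in> e) xs) \<in> {Restr r e, (Restr r e)\<inverse>}"
      by (auto simp: mono_consistent_def Restr_list_order)
    moreover have "e \<subseteq> V" using \<E> that by (auto simp: kgraph_def)
    then have "filter (\<lambda>x. x \<in> e) xs \<in> permutations_of_set e"
      using xs' by (auto simp: permutations_of_set_def)
    ultimately have "filter (\<lambda>x. x \<in> e) xs \<in> F e" by (auto simp: F_def P_def)
    then show False using xs that \<open>e \<subseteq> V\<close> by (auto simp: avoiding_def)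
  qed
  then show ?thesis using linear_order_list_order[OF xs'(1)] xs'(2) by blast
qed

section \<open>Lower bounds\<close>

lemma weak_ES_large_degree:
  assumes k: "k \<ge> 2" and \<E>: "kgraph k V \<E>" and "weak_ES V \<E>"
  obtains v where "v \<in> V" "2 * exp 1 * real (card {e \<in> \<E>. v \<in> e}) > fact (k - 1)"
  using assms exists_inconsistent_order[OF k \<E>] unfolding weak_ES_def by (meson not_le)

lemma linear_kgraph_edges_eq:
  assumes "linear_kgraph k V \<E>" "e \<in> \<E>" "e' \<in> \<E>" "x \<noteq> y" "{x, y} \<subseteq> e" "{x, y} \<subseteq> e'"
  shows "e = e'"
proof (rule ccontr)
  assume "e \<noteq> e'"
  then have "card (e \<inter> e') \<le> 1" and "e \<subseteq> V" "finite V"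
    using assms(1-3) by (auto simp: linear_kgraph_def kgraph_def)
  then have "finite (e \<inter> e')" by (meson finite_Int finite_subset)
  then have "card {x, y} \<le> card (e \<inter> e')"
    using assms(5,6) by (intro card_mono) auto
  then show False using assms(4) \<open>card (e \<inter> e') \<le> 1\<close> by simp
qed

text \<open>Once \<open>v\<close> is removed, the edges through it become pairwise disjoint sets of
  size \<open>k - 1\<close>.\<close>

lemma degree_le_card_vertices:
  assumes "linear_kgraph k V \<E>"
  shows "card {e \<in> \<E>. v \<in> e} * (k - 1) \<le> card V"
proof -
  have fin: "finite V" and sub: "\<And>e. e \<in> \<E> \<Longrightarrow> e \<subseteq> V" and ck: "\<And>e. e \<in> \<E> \<Longrightarrow> card e = k"
    using assms by (auto simp: linear_kgraph_def kgraph_def)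
  have fine: "finite e" if "e \<in> \<E>" for e using sub[OF that] fin finite_subset by blast
  have "finite \<E>" using sub fin by (meson finite_Pow_iff finite_subset PowI subsetI)
  moreover have "(e - {v}) \<inter> (e' - {v}) = {}"
    if "e \<in> \<E>" "e' \<in> \<E>" "v \<in> e" "v \<in> e'" "e \<noteq> e'" for e e'
    using linear_kgraph_edges_eq[OF assms that(1,2), of v] that by fastforce
  ultimately have "card (\<Union>e\<in>{e \<in> \<E>. v \<in> e}. e - {v}) = (\<Sum>e\<in>{e \<in> \<E>. v \<in> e}. card (e - {v}))"
    by (intro card_UN_disjoint) (simp, use fine in simp, simp)
  also have "\<dots> = (\<Sum>e\<in>{e \<in> \<E>. v \<in> e}. k - 1)"
    using ck fine by (intro sum.cong) auto
  finally have "card {e \<in> \<E>. v \<in> e} * (k - 1) = card (\<Union>e\<in>{e \<in> \<E>. v \<in> e}. e - {v})" by simp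
  also have "\<dots> \<le> card V" using fin sub by (intro card_mono) auto
  finally show ?thesis .
qed

text \<open>A vertex of large degree has many neighbours by linearity. This bound exceeds the one in
  the theorem by the factor \<open>k\<close>.\<close>

lemma weak_ES_card_vertices_ge:
  assumes k: "k \<ge> 2" and lin: "linear_kgraph k V \<E>" and weak: "weak_ES V \<E>"
  shows "(real k - 1) * fact (k - 1) / (2 * exp 1) \<le> real (card V)"
proof -
  have "kgraph k V \<E>" using lin by (simp add: linear_kgraph_def)
  from weak_ES_large_degree[OF k this weak] obtain v
    where v: "2 * exp 1 * real (card {e \<in> \<E>. v \<in> e}) > fact (k - 1)" .
  have "(real k - 1) * fact (k - 1) / (2 * exp 1) = fact (k - 1) / (2 * exp 1) * real (k - 1)"
    using k by simp
  also have "\<dots> \<le> real (card {e \<in> \<E>. v \<in> e}) * real (k - 1)"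
    using v by (intro mult_right_mono) (simp_all add: field_simps)
  also have "\<dots> \<le> real (card V)"
    using degree_le_card_vertices[OF lin, of v] by (simp flip: of_nat_mult)
  finally show ?thesis .
qed

text \<open>Add the vertices of \<open>W\<close> successively: a new vertex shares at most one edge
  with each earlier one, so the vertex added after \<open>j\<close> others contributes at least
  \<open>d - j\<close> new edges. Integers avoid truncated subtraction.\<close>

lemma card_edges_ge_high_degrees:
  assumes lin: "linear_kgraph k V \<E>" and "finite W"
    and deg: "\<And>w. w \<in> W \<Longrightarrow> d \<le> card {e \<in> \<E>. w \<in> e}"
  shows "int (card W) * (2 * int d - int (card W)) \<le> 2 * int (card {e \<in> \<E>. e \<inter> W \<noteq> {}})"
  using assms(2,3)
proof (induction W)
  case (insert w W)
  have fin: "finite V" and sub: "\<And>e. e \<in> \<E> \<Longrightarrow> e \<subseteq> V"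
    using lin by (auto simp: linear_kgraph_def kgraph_def)
  have "finite \<E>" using sub fin by (meson finite_Pow_iff finite_subset PowI subsetI)
  then have fins: "finite {e \<in> \<E>. Q e}" for Q by simp
  define A where "A = {e \<in> \<E>. e \<inter> W \<noteq> {}}"
  define Z where "Z = {e \<in> \<E>. w \<in> e}"
  have "A \<inter> Z \<subseteq> (\<Union>w'\<in>W. {e \<in> \<E>. w \<in> e \<and> w' \<in> e})" by (auto simp: A_def Z_def)
  then have "card (A \<inter> Z) \<le> card (\<Union>w'\<in>W. {e \<in> \<E>. w \<in> e \<and> w' \<in> e})"
    using insert.hyps fins by (intro card_mono) auto
  also have "\<dots> \<le> (\<Sum>w'\<in>W. card {e \<in> \<E>. w \<in> e \<and> w' \<in> e})"
    using insert.hyps by (intro card_UN_le)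
  also have "\<dots> \<le> (\<Sum>w'\<in>W. 1)"
  proof (rule sum_mono)
    fix w' assume "w' \<in> W"
    then have "w \<noteq> w'" using insert.hyps by auto
    then show "card {e \<in> \<E>. w \<in> e \<and> w' \<in> e} \<le> 1"
      unfolding One_nat_def using linear_kgraph_edges_eq[OF lin]
      by (subst card_le_Suc0_iff_eq[OF fins]) blast
  qed
  finally have AZ: "card (A \<inter> Z) \<le> card W" by simp
  have "card A + card Z = card (A \<union> Z) + card (A \<inter> Z)"
    using fins by (intro card_Un_Int) (simp_all add: A_def Z_def)
  moreover have "A \<union> Z = {e \<in> \<E>. e \<inter> insert w W \<noteq> {}}" by (auto simp: A_def Z_def)
  moreover have "d \<le> card Z" using insert.prems by (simp add: Z_def)
  moreover have "int (card W) * (2 * int d - int (card W)) \<le> 2 * int (card A)"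
    unfolding A_def using insert by auto
  ultimately show ?case using AZ insert.hyps by (simp add: algebra_simps)
qed simp

lemma mono_consistent_subset:
  assumes "mono_consistent r r' e" "e' \<subseteq> e"
  shows "mono_consistent r r' e'"
proof -
  have "Restr R e' = Restr (Restr R e) e'" for R :: "'a rel" using assms(2) by blast
  then show ?thesis using assms(1) unfolding mono_consistent_def
    by (metis converse_Int converse_Times)
qed

lemma weak_ES_edges_nonempty: "weak_ES V \<E> \<Longrightarrow> \<E> \<noteq> {}"
  unfolding weak_ES_def by blast

text \<open>
  Removing from each edge a vertex of maximum degree preserves the property, so some vertex \<open>v\<close>
  has large degree in the trimmed hypergraph; by linearity the vertices removed from its edges are
  distinct, and each of them has at least the degree of \<open>v\<close>.
\<close>

lemma weak_ES_card_edges_ge: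
  assumes k: "k \<ge> 3" and lin: "linear_kgraph k V \<E>" and weak: "weak_ES V \<E>"
  shows "(fact (k - 2) :: real)^2 / (8 * exp 1 ^ 2) \<le> real (card \<E>)"
proof -
  have fin: "finite V" and sub: "\<And>e. e \<in> \<E> \<Longrightarrow> e \<subseteq> V" and ck: "\<And>e. e \<in> \<E> \<Longrightarrow> card e = k"
    using lin by (auto simp: linear_kgraph_def kgraph_def)
  have fine: "finite e" if "e \<in> \<E>" for e using sub[OF that] fin finite_subset by blast
  have fin\<E>: "finite \<E>" using sub fin by (meson finite_Pow_iff finite_subset PowI subsetI)
  define deg where "deg = (\<lambda>v. card {e \<in> \<E>. v \<in> e})"
  define t where "t = (\<lambda>e. arg_max_on deg e)"
  have t: "t e \<in> e" "\<And>x. x \<in> e \<Longrightarrow> deg x \<le> deg (t e)" if "e \<in> \<E>" for e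
  proof -
    have "e \<noteq> {}" using ck[OF that] k by auto
    then have "finite (deg ` e)" "deg ` e \<noteq> {}" using fine[OF that] by auto
    \<comment> \<open>\<open>arg_max_on\<close> is a choice operator, so a maximizer has to be
      exhibited first; the edge is finite and nonempty.\<close>
    then obtain y where y: "y \<in> e" "\<And>x. x \<in> e \<Longrightarrow> deg x \<le> deg y"
      by (metis (mono_tags, lifting) Max_ge Max_in imageE imageI)
    then have "is_arg_max deg (\<lambda>x. x \<in> e) y" by (auto simp: is_arg_max_def not_less)
    then have "is_arg_max deg (\<lambda>x. x \<in> e) (t e)"
      unfolding t_def arg_max_on_def arg_max_def by (rule someI)
    then show "t e \<in> e" "\<And>x. x \<in> e \<Longrightarrow> deg x \<le> deg (t e)"
      by (auto simp: is_arg_max_def not_less)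
  qed
  define trim where "trim = (\<lambda>e. e - {t e})"
  have ct: "card (trim e) = k - 1" if "e \<in> \<E>" for e
    using ck[OF that] fine[OF that] t(1)[OF that] by (simp add: trim_def)
  \<comment> \<open>As \<open>k \<ge> 3\<close>, a trimmed edge still has two vertices, and these
    determine the original edge.\<close>
  have inj: "inj_on trim \<E>"
  proof (rule inj_onI)
    fix e e' assume e: "e \<in> \<E>" "e' \<in> \<E>" "trim e = trim e'"
    obtain x y where "x \<noteq> y" "{x, y} \<subseteq> trim e"
      using ct[OF e(1)] k card_le_Suc0_iff_eq[of "trim e"] fine[OF e(1)]
      by (fastforce simp: trim_def)
    then show "e = e'"
      using linear_kgraph_edges_eq[OF lin e(1,2), of x y] e(3) by (auto simp: trim_def)
  qed
  have kg: "kgraph (k - 1) V (trim ` \<E>)"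
    using fin sub ct by (auto simp: kgraph_def trim_def)
  have weak': "weak_ES V (trim ` \<E>)"
  proof -
    obtain r where r: "linear_order_on V r"
      "\<And>r'. linear_order_on V r' \<Longrightarrow> \<exists>e\<in>\<E>. mono_consistent r r' e"
      using weak unfolding weak_ES_def by blast
    have "\<exists>e\<in>trim ` \<E>. mono_consistent r r' e" if "linear_order_on V r'" for r'
    proof -
      obtain e where "e \<in> \<E>" "mono_consistent r r' e" using r(2)[OF \<open>linear_order_on V r'\<close>] by blast
      moreover have "trim e \<subseteq> e" by (auto simp: trim_def)
      ultimately show ?thesis using mono_consistent_subset by blast
    qed
    then show ?thesis using r(1) unfolding weak_ES_def by blast
  qed
  have "k - 1 \<ge> 2" using k by simp
  from weak_ES_large_degree[OF this kg weak'] obtain v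
    where v: "2 * exp 1 * real (card {e \<in> trim ` \<E>. v \<in> e}) > fact (k - 1 - 1)" .
  define S where "S = {e \<in> \<E>. v \<in> trim e}"
  have "{e \<in> trim ` \<E>. v \<in> e} = trim ` S" by (auto simp: S_def)
  then have "card {e \<in> trim ` \<E>. v \<in> e} = card S"
    using card_image[OF inj_on_subset[OF inj], of S] by (simp add: S_def)
  then have S: "2 * exp 1 * real (card S) > fact (k - 2)" using v by (simp add: numeral_2_eq_2)
  have finS: "finite S" using fin\<E> by (simp add: S_def)
  \<comment> \<open>Two such edges with the same removed vertex would share both that vertex and
    \<open>v\<close>, which differ because \<open>v\<close> survives the trimming.\<close>
  have "inj_on t S"
  proof (rule inj_onI)
    fix e e' assume "e \<in> S" "e' \<in> S" "t e = t e'"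
    then show "e = e'"
      using linear_kgraph_edges_eq[OF lin, of e e' v "t e"] t(1)[of e] t(1)[of e']
      by (auto simp: S_def trim_def)
  qed
  then have cW: "card (t ` S) = card S" by (rule card_image)
  have high: "card S \<le> card {e \<in> \<E>. w \<in> e}" if "w \<in> t ` S" for w
  proof -
    from that obtain e where e: "e \<in> S" "w = t e" by auto
    have "card S \<le> deg v"
      unfolding deg_def using fin\<E> by (intro card_mono) (auto simp: S_def trim_def)
    also have "\<dots> \<le> deg (t e)" using e t(2)[of e v] by (auto simp: S_def trim_def)
    finally show ?thesis using e by (simp add: deg_def)
  qed
  \<comment> \<open>With \<open>d\<close> and the size of the vertex set both equal to
    \<open>card S\<close>, the estimate says that the square of \<open>card S\<close> is at most
    twice the number of edges.\<close>
  have "int (card (t ` S)) * (2 * int (card S) - int (card (t ` S)))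
      \<le> 2 * int (card {e \<in> \<E>. e \<inter> t ` S \<noteq> {}})"
    by (rule card_edges_ge_high_degrees[OF lin finite_imageI[OF finS] high])
  then have "int (card S) * int (card S) \<le> 2 * int (card {e \<in> \<E>. e \<inter> t ` S \<noteq> {}})"
    by (simp add: cW)
  also have "\<dots> \<le> 2 * int (card \<E>)" using fin\<E> by (simp add: card_mono)
  finally have "real_of_int (int (card S) * int (card S)) \<le> real_of_int (2 * int (card \<E>))"
    by (rule of_int_le_iff[THEN iffD2])
  then have cS: "real (card S) ^ 2 \<le> 2 * real (card \<E>)"
    by (simp add: power2_eq_square)
  have "fact (k - 2) / (2 * exp 1) \<le> real (card S)" using S by (simp add: field_simps)
  then have "(fact (k - 2) / (2 * exp 1)) ^ 2 \<le> real (card S) ^ 2"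
    by (rule power_mono) simp
  with cS have "(fact (k - 2) / (2 * exp 1 :: real)) ^ 2 / 2 \<le> real (card \<E>)" by linarith
  then show ?thesis by (simp add: power_divide power_mult_distrib)
qed

text \<open>For \<open>k = 2\<close> trimming would leave single vertices, but the claimed bound is
  then at most 1 and some edge exists. For larger \<open>k\<close>, \<open>fact k\<close> is at most
  \<open>k ^ 2 * fact (k - 2)\<close>.\<close>

lemma weak_ES_card_edges_ge':
  assumes k: "k \<ge> 2" and lin: "linear_kgraph k V \<E>" and weak: "weak_ES V \<E>"
  shows "(fact k :: real)^2 / (8 * exp 1 ^ 2 * real k ^ 4) \<le> real (card \<E>)"
proof (cases "k = 2")
  case True
  have "finite \<E>" using lin by (auto simp: linear_kgraph_def kgraph_def
      intro: finite_subset[of \<E> "Pow V"])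
  then have "card \<E> \<ge> 1" using weak_ES_edges_nonempty[OF weak] by (simp add: Suc_le_eq card_gt_0_iff)
  moreover have e: "(1::real) \<le> exp 1 ^ 2" by (simp add: one_le_power)
  have "(fact k :: real)^2 / (8 * exp 1 ^ 2 * real k ^ 4) \<le> 1"
    unfolding True by (simp add: fact_numeral divide_le_eq) (use e in linarith)
  ultimately show ?thesis by linarith
next
  case False
  then have "k \<ge> 3" using k by simp
  have "k = Suc (Suc (k - 2))" using k by simp
  then have "fact k = real k * (real (k - 1) * fact (k - 2))"
    by (metis diff_Suc_1 fact_Suc of_nat_mult numeral_2_eq_2 of_nat_fact mult.assoc)
  also have "\<dots> \<le> real k * (real k * fact (k - 2))"
    by (intro mult_left_mono mult_right_mono) auto
  finally have "(fact k :: real) \<le> real k ^ 2 * fact (k - 2)" by (simp add: power2_eq_square mult.assoc)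
  then have "(fact k :: real) ^ 2 \<le> (real k ^ 2 * fact (k - 2)) ^ 2" by (rule power_mono) simp
  then have "(fact k :: real)^2 / (8 * exp 1 ^ 2 * real k ^ 4)
      \<le> (real k ^ 2 * fact (k - 2)) ^ 2 / (8 * exp 1 ^ 2 * real k ^ 4)"
    by (intro divide_right_mono) auto
  also have "\<dots> = (fact (k - 2) :: real)^2 / (8 * exp 1 ^ 2)"
    using k by (simp add: power_mult_distrib)
  also have "\<dots> \<le> real (card \<E>)" by (rule weak_ES_card_edges_ge[OF \<open>k \<ge> 3\<close> lin weak])
  finally show ?thesis .
qed

section \<open>A linear hypergraph with the strong property\<close>

text \<open>The pigeonhole proof: label each element with the maximal sizes of a chain ending there
  in \<open>r \<inter> r'\<close> and in \<open>r \<inter> r'\<inverse>\<close>. Any two elements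
  are comparable in one of these relations, so labels are distinct; without a consistent
  \<open>k\<close>-set they lie in a grid of side \<open>k - 1\<close>.\<close>

lemma Erdos_Szekeres_mono_consistent:
  assumes k: "k \<ge> 1" and r: "linear_order_on V r" and r': "linear_order_on V r'"
    and S: "finite S" "S \<subseteq> V" "card S > (k - 1)^2"
  shows "\<exists>e\<subseteq>S. card e = k \<and> mono_consistent r r' e"
proof (rule ccontr)
  assume no: "\<not> ?thesis"
  have lin: "refl_on V r" "trans r" "antisym r" "total_on V r"
      "refl_on V r'" "trans r'" "antisym r'" "total_on V r'"
    using r r' by (auto simp: order_on_defs)
  \<comment> \<open>The sets of pairwise \<open>R\<close>-comparable elements of \<open>S\<close>
    with \<open>x\<close> as last element.\<close>
  define chains where "chains = (\<lambda>R x. {C. C \<subseteq> S \<and> x \<in> C \<and> (\<forall>y\<in>C. (y, x) \<in> R) \<and>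
    (\<forall>y\<in>C. \<forall>z\<in>C. (y, z) \<in> R \<or> (z, y) \<in> R)})"
  define len where "len = (\<lambda>R x. Max (card ` chains R x))"
  define up where "up = r \<inter> r'"
  define down where "down = r \<inter> r'\<inverse>"
  have fin: "finite (chains R x)" for R x
    by (rule finite_subset[of _ "Pow S"]) (use S(1) in \<open>auto simp: chains_def\<close>)
  have refl: "(x, x) \<in> R" if "x \<in> S" "R \<in> {up, down}" for x R
    using that lin(1,5) S(2) by (auto simp: up_def down_def refl_on_def)
  have single: "{x} \<in> chains R x" if "x \<in> S" "R \<in> {up, down}" for x R
    using that refl by (auto simp: chains_def)
  have small: "card C < k" if C: "C \<in> chains R x" "R \<in> {up, down}" for C R x
  proof (rule ccontr)
    assume "\<not> card C < k"
    then obtain e where e: "e \<subseteq> C" "card e = k" by (meson not_less obtain_subset_with_card_n)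
    have comp: "(y, z) \<in> R \<or> (z, y) \<in> R" if "y \<in> e" "z \<in> e" for y z
      using that e(1) C(1) unfolding chains_def by blast
    have "e \<subseteq> S" using e C(1) by (auto simp: chains_def)
    \<comment> \<open>Both relations are contained in \<open>r\<close>. On a chain every pair is
      comparable in \<open>R\<close>, so antisymmetry of \<open>r\<close> leaves no further pairs in
      \<open>r\<close>.\<close>
    have r_iff: "(y, z) \<in> r \<longleftrightarrow> (y, z) \<in> R" if "y \<in> e" "z \<in> e" for y z
      using comp[OF that] C(2) refl[of y R] that \<open>e \<subseteq> S\<close> antisymD[OF lin(3), of y z]
      by (auto simp: up_def down_def)
    have "mono_consistent r r' e"
    proof (cases "R = up")
      case True
      have "(y, z) \<in> r' \<longleftrightarrow> (y, z) \<in> R" if "y \<in> e" "z \<in> e" for y z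
        using comp[OF that] True refl[of y R] that \<open>e \<subseteq> S\<close> antisymD[OF lin(7), of y z]
        by (auto simp: up_def)
      then show ?thesis using r_iff by (auto simp: mono_consistent_def)
    next
      case False
      then have R: "R = down" using C(2) by simp
      have "(y, z) \<in> r' \<longleftrightarrow> (z, y) \<in> R" if "y \<in> e" "z \<in> e" for y z
        using comp[OF that] R refl[of y R] that \<open>e \<subseteq> S\<close> antisymD[OF lin(7), of y z]
        by (auto simp: down_def)
      then show ?thesis using r_iff by (auto simp: mono_consistent_def)
    qed
    then show False using no \<open>e \<subseteq> S\<close> e(2) by blast
  qed
  have len_range: "len R x \<in> {1..k - 1}" if x: "x \<in> S" "R \<in> {up, down}" for x R
  proof -
    have "len R x \<in> card ` chains R x"
      unfolding len_def using fin single[OF x] by (intro Max_in) auto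
    then have "len R x < k" using small x by auto
    moreover have "card {x} \<le> len R x"
      unfolding len_def using fin imageI[OF single[OF x], of card] by (intro Max_ge) auto
    ultimately show ?thesis by auto
  qed
  \<comment> \<open>A longest chain ending in \<open>x\<close> can be extended by
    \<open>y\<close>.\<close>
  have len_less: "len R x < len R y" if xy: "x \<in> S" "y \<in> S" "(x, y) \<in> R" "x \<noteq> y" "R \<in> {up, down}" for x y R
  proof -
    have tr: "trans R" and anti: "antisym R"
      using xy(5) lin by (auto simp: up_def down_def trans_Int antisym_def)
    have "len R x \<in> card ` chains R x"
      unfolding len_def using fin single[OF xy(1,5)] by (intro Max_in) auto
    then obtain C where C: "C \<in> chains R x" "len R x = card C" by auto
    have below: "(z, y) \<in> R" if "z \<in> C" for z
      using that C(1) transD[OF tr _ xy(3)] by (auto simp: chains_def)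
    have "y \<notin> C" using C(1) xy antisymD[OF anti] by (auto simp: chains_def)
    have "insert y C \<in> chains R y" using below C(1) xy refl by (auto simp: chains_def)
    then have "card (insert y C) \<le> len R y"
      unfolding len_def using fin by (intro Max_ge) auto
    moreover have "finite C" using C(1) S(1) by (auto simp: chains_def intro: finite_subset)
    ultimately show ?thesis using C(2) \<open>y \<notin> C\<close> by simp
  qed
  have "inj_on (\<lambda>x. (len up x, len down x)) S"
  proof (rule inj_onI, rule ccontr)
    fix x y assume xy: "x \<in> S" "y \<in> S" "(len up x, len down x) = (len up y, len down y)" "x \<noteq> y"
    have "x \<in> V" "y \<in> V" using xy S by auto
    then consider "(x, y) \<in> up" | "(y, x) \<in> up" | "(x, y) \<in> down" | "(y, x) \<in> down"
      using lin(4,8) xy(4) by (auto simp: up_def down_def total_on_def)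
    then show False
      using len_less[of x y up] len_less[of y x up] len_less[of x y down] len_less[of y x down] xy
      by cases auto
  qed
  then have "card S \<le> card ({1..k - 1} \<times> {1..k - 1})"
    using len_range by (intro card_inj_on_le) auto
  then show False using S(3) by (simp add: power2_eq_square)
qed

section \<open>The number of linear orders\<close>

text \<open>A linear order is determined by the number of elements below each element. The resulting
  crude bound replaces the exact factorial; it suffices for the union bound.\<close>

lemma card_linear_orders_le:
  fixes V :: "'a set"
  assumes "finite V"
  shows "finite {r. linear_order_on V r}" "card {r. linear_order_on V r} \<le> card V ^ card V"
proof -
  \<comment> \<open>Restricting the function to \<open>V\<close> makes it extensional, hence a
    member of a finite function space. An element counts itself, so ranks start at 1.\<close>
  define rank :: "'a rel \<Rightarrow> 'a \<Rightarrow> nat" where "rank = (\<lambda>r. \<lambda>x\<in>V. card {y. (y, x) \<in> r})"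
  have sub: "r \<subseteq> V \<times> V" if "linear_order_on V r" for r
    using that by (auto simp: order_on_defs)
  have below: "{y. (y, x) \<in> r} \<subseteq> V" if "linear_order_on V r" for r x
    using sub[OF that] by auto
  have iff: "(x, y) \<in> r \<longleftrightarrow> rank r x \<le> rank r y"
    if r: "linear_order_on V r" and xy: "x \<in> V" "y \<in> V" for r x y
  proof -
    have lin: "refl_on V r" "trans r" "antisym r" "total_on V r"
      using r by (auto simp: order_on_defs)
    have fin: "finite {y. (y, x) \<in> r}" for x
      using below[OF r] assms finite_subset by blast
    have le: "rank r a \<le> rank r b" if "(a, b) \<in> r" for a b
      unfolding rank_def using that sub[OF r] transD[OF lin(2)] fin by (auto intro!: card_mono)
    have less: "rank r a < rank r b" if "(a, b) \<in> r" "a \<noteq> b" for a b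
    proof -
      have "a \<in> V" "b \<in> V" using that sub[OF r] by auto
      moreover have "{y. (y, a) \<in> r} \<subset> {y. (y, b) \<in> r}"
        using that transD[OF lin(2)] antisymD[OF lin(3)] refl_onD[OF lin(1) \<open>b \<in> V\<close>] by blast
      ultimately show ?thesis unfolding rank_def by (auto intro!: psubset_card_mono fin)
    qed
    show ?thesis
      using le[of x y] less[of y x] lin(4) xy refl_onD[OF lin(1)]
      unfolding total_on_def by (metis not_less)
  qed
  have inj: "inj_on rank {r. linear_order_on V r}"
  proof (rule inj_onI)
    fix r r' assume "r \<in> {r. linear_order_on V r}" "r' \<in> {r. linear_order_on V r}" "rank r = rank r'"
    then show "r = r'" using iff[of r] iff[of r'] sub[of r] sub[of r'] by auto
  qed
  have "rank r x \<in> {1..card V}" if "linear_order_on V r" "x \<in> V" for r x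
  proof -
    have "finite {y. (y, x) \<in> r}" using below[OF that(1)] assms finite_subset by blast
    moreover have "(x, x) \<in> r" using that by (auto simp: order_on_defs refl_on_def)
    ultimately have "card {y. (y, x) \<in> r} > 0" by (auto simp: card_gt_0_iff)
    moreover have "card {y. (y, x) \<in> r} \<le> card V" using below[OF that(1)] assms by (intro card_mono)
    ultimately show ?thesis using that(2) by (simp add: rank_def)
  qed
  then have "rank ` {r. linear_order_on V r} \<subseteq> V \<rightarrow>\<^sub>E {1..card V}"
    by (auto simp: rank_def)
  moreover have "finite (V \<rightarrow>\<^sub>E {1..card V})" using assms by (intro finite_PiE) auto
  ultimately have "finite {r. linear_order_on V r}"
    "card {r. linear_order_on V r} \<le> card (V \<rightarrow>\<^sub>E {1..card V})"
    using inj_on_finite[OF inj] card_inj_on_le[OF inj] by blast+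
  then show "finite {r. linear_order_on V r}" "card {r. linear_order_on V r} \<le> card V ^ card V"
    using assms by (simp_all add: card_PiE)
qed

text \<open>
  The method of conditional expectations: choosing \<open>f i\<close> uniformly at random in \<open>C i\<close>, each
  \<open>p\<close> is missed with probability at most \<open>(1 - 1 / b)\<close> at every \<open>i\<close>.
\<close>

lemma exists_choice_few_missed:
  assumes "finite I" "finite P" "b > 0"
    and "\<And>i. i \<in> I \<Longrightarrow> finite (C i) \<and> card (C i) = b"
    and "\<And>i p. i \<in> I \<Longrightarrow> p \<in> P \<Longrightarrow> \<exists>c\<in>C i. hit p c"
  shows "\<exists>f. (\<forall>i\<in>I. f i \<in> C i) \<and>
    real (card {p \<in> P. \<forall>i\<in>I. \<not> hit p (f i)}) \<le> real (card P) * (1 - 1 / real b) ^ card I"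
  using assms(1,4,5)
proof (induction I)
  case (insert i I)
  then obtain f where f: "\<forall>i\<in>I. f i \<in> C i"
    "real (card {p \<in> P. \<forall>i\<in>I. \<not> hit p (f i)}) \<le> real (card P) * (1 - 1 / real b) ^ card I"
    by auto
  define U where "U = {p \<in> P. \<forall>i\<in>I. \<not> hit p (f i)}"
  have finU: "finite U" using assms(2) by (simp add: U_def)
  have C: "finite (C i)" "card (C i) = b" using insert.prems by auto
  \<comment> \<open>Averaging: every member of \<open>U\<close> is hit by at least one of the
    \<open>b\<close> choices, so some choice hits at least the fraction \<open>1 / b\<close> of
    \<open>U\<close>.\<close>
  have "\<exists>c\<in>C i. real (card U) / b \<le> real (card {p \<in> U. hit p c})"
  proof (rule ccontr)
    assume "\<not> ?thesis"
    then have "(\<Sum>c\<in>C i. real (card {p \<in> U. hit p c})) < (\<Sum>c\<in>C i. real (card U) / b)"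
      using C assms(3) by (intro sum_strict_mono) (auto simp: not_le)
    also have "\<dots> = real (card U)" using C assms(3) by simp
    finally have "real (\<Sum>c\<in>C i. card {p \<in> U. hit p c}) < real (card U)" by simp
    then have less: "(\<Sum>c\<in>C i. card {p \<in> U. hit p c}) < card U" by (simp only: of_nat_less_iff)
    have "U \<subseteq> (\<Union>c\<in>C i. {p \<in> U. hit p c})" using insert.prems(2)[of i] by (auto simp: U_def)
    then have "card U \<le> card (\<Union>c\<in>C i. {p \<in> U. hit p c})"
      using finU C by (intro card_mono) auto
    also have "\<dots> \<le> (\<Sum>c\<in>C i. card {p \<in> U. hit p c})" by (rule card_UN_le[OF C(1)])
    finally show False using less by simp
  qed
  then obtain c where c: "c \<in> C i" "real (card U) / b \<le> real (card {p \<in> U. hit p c})" by auto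
  have "{p \<in> P. \<forall>j\<in>insert i I. \<not> hit p ((f(i := c)) j)} = U - {p \<in> U. hit p c}"
    using insert.hyps by (auto simp: U_def)
  then have "real (card {p \<in> P. \<forall>j\<in>insert i I. \<not> hit p ((f(i := c)) j)})
      = real (card U) - real (card {p \<in> U. hit p c})"
    using finU by (simp add: card_Diff_subset of_nat_diff card_mono)
  also have "\<dots> \<le> real (card U) * (1 - 1 / real b)"
    using c(2) by (simp add: algebra_simps)
  also have "\<dots> \<le> real (card P) * (1 - 1 / real b) ^ card I * (1 - 1 / real b)"
    using f(2) assms(3) by (intro mult_right_mono) (auto simp: U_def)
  also have "\<dots> = real (card P) * (1 - 1 / real b) ^ card (insert i I)"
    using insert.hyps by simp
  finally show ?case using f(1) c(1) insert.hyps by (intro exI[of _ "f(i := c)"]) auto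
qed simp

section \<open>A linear hypergraph of lines, and random subsets of its edges\<close>

definition modular_line :: "nat \<Rightarrow> nat \<Rightarrow> nat \<times> nat \<Rightarrow> (nat \<times> nat) set" where
  "modular_line N m = (\<lambda>(a, b). (\<lambda>x. (x, (a * x + b) mod m)) ` {..<N})"

text \<open>
  The slopes stay below \<open>s\<close>, so the product of a difference of slopes and a difference of abscissae
  is smaller than the modulus and needs no inverse.
\<close>

lemma card_modular_line_Int:
  assumes "i \<in> {..<s} \<times> {..<s * N}" "j \<in> {..<s} \<times> {..<s * N}" "i \<noteq> j"
  shows "card (modular_line N (s * N) i \<inter> modular_line N (s * N) j) \<le> 1"
proof -
  define m where "m = s * N"
  obtain a b a' b' where ij: "i = (a, b)" "j = (a', b')" by (cases i, cases j)
  then have lt: "a < s" "b < m" "a' < s" "b' < m" using assms by (auto simp: m_def)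
  have "x = x'" if x: "x < N" "x' < N" "(a * x + b) mod m = (a' * x + b') mod m"
      "(a * x' + b) mod m = (a' * x' + b') mod m" for x x'
  proof (rule ccontr)
    assume ne: "x \<noteq> x'"
    have "int m dvd (int a * int x + int b) - (int a' * int x + int b')"
      "int m dvd (int a * int x' + int b) - (int a' * int x' + int b')"
      using x(3,4) by (simp_all flip: of_nat_mult of_nat_add of_nat_mod add: mod_eq_dvd_iff[symmetric])
    \<comment> \<open>Subtracting the two congruences eliminates both intercepts.\<close>
    then have "int m dvd ((int a * int x + int b) - (int a' * int x + int b'))
        - ((int a * int x' + int b) - (int a' * int x' + int b'))"
      by (rule dvd_diff)
    then have "int m dvd (int a - int a') * (int x - int x')" by (simp add: algebra_simps)
    moreover have "\<bar>(int a - int a') * (int x - int x')\<bar> < int m"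
    proof -
      have "\<bar>int a - int a'\<bar> * \<bar>int x - int x'\<bar> \<le> (int s - 1) * (int N - 1)"
        using lt x by (intro mult_mono) auto
      also have "\<dots> < int s * int N" using lt x by (simp add: algebra_simps)
      finally show ?thesis by (simp add: abs_mult m_def)
    qed
    ultimately have "(int a - int a') * (int x - int x') = 0"
      by (meson dvd_imp_le_int not_less abs_of_nat order_less_le_trans zdvd_not_zless dvd_abs_iff
          abs_ge_zero order_le_less zero_less_abs_iff)
    \<comment> \<open>With equal slopes the intercepts are congruent modulo \<open>m\<close>, and
      both lie below \<open>m\<close>, so the two lines have the same index.\<close>
    then have aa: "a = a'" using ne by simp
    then have "int m dvd int b - int b'"
      using \<open>int m dvd (int a * int x + int b) - (int a' * int x + int b')\<close> by simp
    then have "b mod m = b' mod m" by (metis mod_eq_dvd_iff of_nat_eq_iff of_nat_mod)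
    then show False using lt aa assms(3) ij by simp
  qed
  then have "\<forall>p\<in>modular_line N m i \<inter> modular_line N m j. \<forall>q\<in>modular_line N m i \<inter> modular_line N m j. p = q"
    unfolding modular_line_def ij by auto
  moreover have "finite (modular_line N m i \<inter> modular_line N m j)"
    by (auto simp: modular_line_def split: prod.splits)
  ultimately show ?thesis unfolding m_def by (simp add: card_le_Suc0_iff_eq)
qed

lemma card_modular_line: "card (modular_line N m i) = N"
  unfolding modular_line_def by (cases i) (auto simp: card_image inj_on_def)

text \<open>Union bound with \<open>n = N^2 * s\<close> vertices: there are at most
  \<open>n ^ (2 * n)\<close> pairs of orders, and a pair is missed on all \<open>N * s^2\<close>
  lines with probability at most \<open>(1 - 1 / B) ^ (N * s^2)\<close>, where \<open>B\<close> is
  \<open>N choose k\<close>. The hypothesis on \<open>s\<close> makes the product smaller than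
  1.\<close>

lemma exists_strong_ES:
  fixes k s :: nat
  defines "N \<equiv> (k - 1)^2 + 1"
  assumes k: "k \<ge> 2" and s: "2 * real N * real (N choose k) * ln (real (N^2 * s)) < real s"
  obtains V :: "nat set" and \<E> where "linear_kgraph k V \<E>" "strong_ES V \<E>"
    "card V = N^2 * s" "card \<E> \<le> N * s^2"
proof -
  define B where "B = N choose k"
  define V where "V = {..<N} \<times> {..<s * N}"
  define I where "I = {..<s} \<times> {..<s * N}"
  define line where "line = modular_line N (s * N)"
  define C where "C = (\<lambda>i. {e. e \<subseteq> line i \<and> card e = k})"
  define P where "P = {r. linear_order_on V r} \<times> {r. linear_order_on V r}"
  define hit :: "(nat \<times> nat) rel \<times> (nat \<times> nat) rel \<Rightarrow> (nat \<times> nat) set \<Rightarrow> bool" where "hit = (\<lambda>(r, r') e. mono_consistent r r' e)"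
  have N: "N \<ge> 2" using k by (simp add: N_def)
  have s0: "s > 0"
    using s by (cases "s = 0") auto
  have "k - 1 \<le> (k - 1)^2" by (cases "k - 1") (auto simp: power2_eq_square)
  then have "k \<le> N" by (simp add: N_def)
  then have B: "B > 0" by (simp add: B_def)
  have finV: "finite V" by (simp add: V_def)
  have cV: "card V = N^2 * s" by (simp add: V_def power2_eq_square)
  have cI: "card I = N * s^2" by (simp add: I_def power2_eq_square)
  have finl: "finite (line i)" for i by (auto simp: line_def modular_line_def split: prod.splits)
  have lV: "line i \<subseteq> V" if "i \<in> I" for i
    using that by (auto simp: line_def modular_line_def V_def I_def)
  have "\<exists>f. (\<forall>i\<in>I. f i \<in> C i) \<and>
      real (card {p \<in> P. \<forall>i\<in>I. \<not> hit p (f i)}) \<le> real (card P) * (1 - 1 / real B) ^ card I"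
  proof (rule exists_choice_few_missed)
    show "finite P" using card_linear_orders_le[OF finV] by (simp add: P_def)
    show "finite (C i) \<and> card (C i) = B" for i
      using n_subsets[OF finl, of i k] finite_subset[of "C i" "Pow (line i)"] finl[of i]
      by (auto simp: C_def B_def line_def card_modular_line)
    show "\<exists>c\<in>C i. hit p c" if i: "i \<in> I" and p: "p \<in> P" for i p
    proof -
      obtain r r' where p': "p = (r, r')" "linear_order_on V r" "linear_order_on V r'"
        using p by (auto simp: P_def)
      have "card (line i) > (k - 1)^2" by (simp add: line_def card_modular_line N_def)
      then obtain e where "e \<subseteq> line i" "card e = k" "mono_consistent r r' e"
        using Erdos_Szekeres_mono_consistent[OF _ p'(2,3) finl lV[OF i]] k by (metis One_nat_def Suc_leD numeral_2_eq_2)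
      then show ?thesis by (auto simp: C_def hit_def p'(1))
    qed
  qed (use B in \<open>simp_all add: I_def\<close>)
  then obtain f where f: "\<And>i. i \<in> I \<Longrightarrow> f i \<in> C i"
    "real (card {p \<in> P. \<forall>i\<in>I. \<not> hit p (f i)}) \<le> real (card P) * (1 - 1 / real B) ^ card I"
    by blast
  define n where "n = N^2 * s"
  have n: "n > 0" using N s0 by (simp add: n_def)
  have "card P = card {r. linear_order_on V r} ^ 2"
    by (simp add: P_def card_cartesian_product power2_eq_square)
  also have "\<dots> \<le> (n ^ n) ^ 2"
    using card_linear_orders_le(2)[OF finV] by (intro power_mono) (simp_all add: cV n_def)
  finally have "real (card P) \<le> real ((n ^ n) ^ 2)" by (rule of_nat_mono)
  also have "\<dots> = exp (2 * (real n * ln (real n)))"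
    using n by (simp add: exp_of_nat_mult exp_double flip: power_mult)
  finally have cP: "real (card P) \<le> exp (2 * (real n * ln (real n)))" .
  have "(1 - 1 / real B) ^ card I \<le> exp (- 1 / real B) ^ card I"
    using B exp_ge_add_one_self[of "- 1 / real B"] by (intro power_mono) (auto simp: field_simps)
  also have "\<dots> = exp (- real (card I) / real B)" by (simp flip: exp_of_nat_mult)
  finally have cQ: "(1 - 1 / real B) ^ card I \<le> exp (- real (card I) / real B)" .
  \<comment> \<open>Dividing \<open>2 n ln n < N s^2 / B\<close> by \<open>N s / B\<close> gives
    exactly the hypothesis on \<open>s\<close>.\<close>
  have "2 * (real n * ln (real n)) * real B = real N * real s * (2 * real N * real B * ln (real (N^2 * s)))"
    by (simp add: n_def power2_eq_square)
  also have "\<dots> < real N * real s * real s"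
    using s N s0 by (intro mult_strict_left_mono) (auto simp: B_def)
  also have "\<dots> = real (card I)" by (simp add: cI power2_eq_square)
  finally have key: "2 * (real n * ln (real n)) < real (card I) / real B"
    using B by (simp add: pos_less_divide_eq)
  have "real (card P) * (1 - 1 / real B) ^ card I
      \<le> exp (2 * (real n * ln (real n))) * exp (- real (card I) / real B)"
    using B by (intro mult_mono cP cQ) auto
  also have "\<dots> < 1" using key by (simp flip: exp_add)
  \<comment> \<open>A natural number below 1 is 0, so no pair of orders is missed.\<close>
  finally have "card {p \<in> P. \<forall>i\<in>I. \<not> hit p (f i)} = 0" using f(2) by linarith
  moreover have "finite {p \<in> P. \<forall>i\<in>I. \<not> hit p (f i)}"
    using card_linear_orders_le(1)[OF finV] by (simp add: P_def)
  ultimately have "{p \<in> P. \<forall>i\<in>I. \<not> hit p (f i)} = {}" by simp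
  then have hits: "\<exists>i\<in>I. hit p (f i)" if "p \<in> P" for p using that by blast
  have fl: "f i \<subseteq> line i" "card (f i) = k" if "i \<in> I" for i
    using f(1)[OF that] by (auto simp: C_def)
  have "card (f i \<inter> f j) \<le> 1" if "i \<in> I" "j \<in> I" "f i \<noteq> f j" for i j
  proof -
    have "card (f i \<inter> f j) \<le> card (line i \<inter> line j)"
      using fl(1)[of i] fl(1)[of j] that finl by (intro card_mono) auto
    also have "\<dots> \<le> 1"
      unfolding line_def using that by (intro card_modular_line_Int) (auto simp: I_def)
    finally show ?thesis .
  qed
  then have lin: "linear_kgraph k V (f ` I)"
    using finV fl lV unfolding linear_kgraph_def kgraph_def by blast
  have strong: "strong_ES V (f ` I)"
    unfolding strong_ES_def using hits by (auto simp: P_def hit_def)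
  have "finite I" by (simp add: I_def)
  from card_image_le[OF this, of f] have cE: "card (f ` I) \<le> N * s^2" unfolding cI .
  show ?thesis
    using nat_copy[OF lin] strong cV cE that by metis
qed

section \<open>Asymptotics of the binomial coefficient\<close>

text \<open>Expresses the partial products of Wallis through factorials, so that their logarithms
  become combinations of \<open>stirling_error\<close>.\<close>

lemma wallis_product_eq:
  "(\<Prod>k=1..n. (4 * real k ^ 2) / (4 * real k ^ 2 - 1)) =
    (2 ^ n * fact n) ^ 4 / (fact (2 * n) ^ 2 * (2 * real n + 1))"
proof (induction n)
  case (Suc n)
  have "fact (2 * Suc n) = (2 * real n + 2) * (2 * real n + 1) * fact (2 * n)"
    by (simp add: algebra_simps)
  moreover have "4 * real (Suc n) ^ 2 - 1 = (2 * real n + 1) * (2 * real n + 3)"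
    by (simp add: power2_eq_square algebra_simps)
  moreover have "2 * real (Suc n) + 1 = 2 * real n + 3" by simp
  moreover have "2 * real n + 1 \<noteq> 0" "2 * real n + 3 \<noteq> 0" "2 * real n + 2 \<noteq> 0"
    by (auto simp: add_eq_0_iff)
  moreover have "2 ^ Suc n * fact (Suc n) = (2 * real n + 2) * (2 ^ n * fact n)"
    by (simp add: algebra_simps)
  moreover have "4 * real (Suc n) ^ 2 = (2 * real n + 2) ^ 2"
    by (simp add: power2_eq_square algebra_simps)
  \<comment> \<open>The algebra of the induction step: \<open>A\<close> is
    \<open>2 ^ n * fact n\<close>, \<open>F\<close> is \<open>fact (2 * n)\<close>, and
    \<open>x\<close>, \<open>y\<close>, \<open>z\<close> are \<open>2 * n + 1\<close>,
    \<open>2 * n + 2\<close>, \<open>2 * n + 3\<close>.\<close>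
  moreover have "A ^ 4 / (F ^ 2 * x) * (y ^ 2 / (x * z)) = (y * A) ^ 4 / ((y * x * F) ^ 2 * z)"
    if "x \<noteq> 0" "y \<noteq> 0" "z \<noteq> 0" "F \<noteq> 0" for A F x y z :: real
    using that by (simp add: divide_simps) (simp add: eval_nat_numeral)
  ultimately show ?case
    by (simp only: prod.cl_ivl_Suc Suc fact_nonzero) simp
qed simp

text \<open>For positive \<open>n\<close>, the logarithm of
  \<open>fact n / (sqrt n * (n / e) ^ n)\<close>.\<close>

definition stirling_error :: "nat \<Rightarrow> real" where
  "stirling_error n = ln (fact n) - (real n + 1 / 2) * ln (real n) + real n"

text \<open>Consecutive differences are of order \<open>1 / n^2\<close>, hence summable, and they
  telescope. The shift by one keeps the arguments of \<open>ln\<close> positive.\<close>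

lemma convergent_stirling_error: "convergent stirling_error"
proof -
  define d where "d = (\<lambda>n. stirling_error (Suc n))"
  have diff: "d (Suc n) - d n = 1 - (real n + 3 / 2) * (ln (real n + 2) - ln (real n + 1))" for n
  proof -
    have "ln (fact (Suc (Suc n))) = ln (real n + 2) + ln (fact (Suc n) :: real)"
      by (subst fact_Suc, subst ln_mult) (auto simp: add_ac)
    moreover have "real (Suc (Suc n)) = real n + 2" "real (Suc n) = real n + 1" by simp_all
    ultimately show ?thesis
      unfolding d_def stirling_error_def by (simp only:) (simp add: algebra_simps)
  qed
  have "(\<lambda>n. 1 - (real n + 3 / 2) * (ln (real n + 2) - ln (real n + 1))) \<in> O(\<lambda>n. 1 / real n ^ 2)"
    by real_asymp
  moreover have "summable (\<lambda>n. norm (1 / real n ^ 2))"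
    using inverse_power_summable[of 2, where ?'a = real] by (simp add: inverse_eq_divide)
  ultimately have "summable (\<lambda>n. d (Suc n) - d n)"
    unfolding diff by (rule summable_comparison_test_bigo[rotated])
  then have "convergent (\<lambda>n. \<Sum>i<n. d (Suc i) - d i)" by (simp add: summable_iff_convergent)
  then have "convergent (\<lambda>n. (d n - d 0) + d 0)"
    unfolding sum_lessThan_telescope by (intro convergent_add convergent_const)
  then show ?thesis unfolding d_def by (simp add: convergent_Suc_iff)
qed

text \<open>Stirling's formula; the constant comes from Wallis' product.\<close>

lemma stirling_error_tendsto: "stirling_error \<longlonglongrightarrow> ln (2 * pi) / 2"
proof -
  obtain c where c: "stirling_error \<longlonglongrightarrow> c"
    using convergent_stirling_error by (auto simp: convergent_def)
  define w where "w = (\<lambda>n. \<Prod>k=1..n. (4 * real k ^ 2) / (4 * real k ^ 2 - 1))"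
  have w: "(\<lambda>n. ln (w n)) \<longlonglongrightarrow> ln (pi / 2)"
    unfolding w_def by (intro tendsto_ln wallis) simp
  \<comment> \<open>In this combination the terms of order \<open>n * ln n\<close> and
    \<open>n\<close> cancel.\<close>
  have eq: "ln (w n) = 4 * stirling_error n - 2 * stirling_error (2 * n)
      + (ln (real n) - ln 2 - ln (2 * real n + 1))" if n: "n > 0" for n
  proof -
    have "ln (w n) = 4 * ln (2 ^ n * fact n :: real) - ln (fact (2 * n) ^ 2 * (2 * real n + 1))"
      unfolding w_def wallis_product_eq using n by (subst ln_div) (auto simp: ln_realpow add_pos_pos)
    also have "\<dots> = 4 * (real n * ln 2 + ln (fact n)) - (2 * ln (fact (2 * n)) + ln (2 * real n + 1))"
      using n by (simp add: ln_mult ln_realpow add_pos_pos)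
    also have "ln (fact n) = stirling_error n + (real n + 1 / 2) * ln (real n) - real n"
      by (simp add: stirling_error_def)
    also have "ln (fact (2 * n)) =
        stirling_error (2 * n) + (2 * real n + 1 / 2) * (ln 2 + ln (real n)) - 2 * real n"
      using n by (simp add: stirling_error_def ln_mult)
    finally show ?thesis by (simp add: algebra_simps)
  qed
  have "(\<lambda>n. stirling_error (2 * n)) \<longlonglongrightarrow> c"
    using LIMSEQ_subseq_LIMSEQ[OF c, of "\<lambda>n. 2 * n"] by (simp add: strict_mono_def o_def)
  moreover have "(\<lambda>n. ln (real n) - ln 2 - ln (2 * real n + 1)) \<longlonglongrightarrow> - ln 2 - ln 2"
    by real_asymp
  ultimately have "(\<lambda>n. 4 * stirling_error n - 2 * stirling_error (2 * n)
      + (ln (real n) - ln 2 - ln (2 * real n + 1))) \<longlonglongrightarrow> 4 * c - 2 * c + (- ln 2 - ln 2)"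
    by (intro tendsto_add[OF tendsto_diff[OF tendsto_mult[OF tendsto_const c]
          tendsto_mult[OF tendsto_const]]])
  moreover have "\<forall>\<^sub>F n in sequentially. ln (w n) = 4 * stirling_error n - 2 * stirling_error (2 * n)
      + (ln (real n) - ln 2 - ln (2 * real n + 1))"
    using eventually_gt_at_top[of 0] by eventually_elim (rule eq)
  ultimately have "(\<lambda>n. ln (w n)) \<longlonglongrightarrow> 4 * c - 2 * c + (- ln 2 - ln 2)"
    by (simp only: tendsto_cong)
  \<comment> \<open>Comparing both limits determines the constant:
    \<open>2 * c = ln (pi / 2) + 2 * ln 2\<close>.\<close>
  then have "4 * c - 2 * c + (- ln 2 - ln 2) = ln (pi / 2)"
    using w LIMSEQ_unique by blast
  then have "c = ln (2 * pi) / 2" by (simp add: ln_div ln_mult)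
  then show ?thesis using c by (simp only:)
qed

section \<open>The binomial coefficient up to a vanishing logarithmic error\<close>

text \<open>For \<open>0 \<le> x \<le> 1 / 2\<close>, \<open>ln (1 - x)\<close> lies between
  \<open>- x - 2 * x^2\<close> and \<open>- x\<close>. The linear terms sum to about
  \<open>- k^2 / (2 * k^2)\<close>, while the quadratic ones contribute only
  \<open>O(1 / k)\<close>.\<close>

lemma sum_ln_one_minus_tendsto:
  "(\<lambda>k. \<Sum>i<k. ln (1 - real i / real ((k - 1)^2 + 1))) \<longlonglongrightarrow> - 1 / 2"
proof (rule tendsto_sandwich)
  have N: "real ((k - 1)^2 + 1) = (real k - 1)^2 + 1" if "k \<ge> 2" for k
    using that by (simp add: of_nat_diff)
  have sum_i: "(\<Sum>i<k. real i) = real k * (real k - 1) / 2" for k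
    by (induction k) (auto simp: field_simps)
  \<comment> \<open>The square of \<open>k - 2\<close> is nonnegative, so \<open>2 * (k - 1)\<close>
    is at most \<open>(k - 1)^2 + 1\<close>.\<close>
  have half: "0 \<le> real i / ((real k - 1)^2 + 1)" "real i / ((real k - 1)^2 + 1) \<le> 1 / 2"
    if "i < k" for i k
  proof -
    have "2 * real i \<le> 2 * (real k - 1)" using that by simp
    also have "\<dots> \<le> (real k - 1)^2 + 1"
      using zero_le_power2[of "real k - 2"] by (simp add: power2_eq_square algebra_simps)
    finally show "real i / ((real k - 1)^2 + 1) \<le> 1 / 2"
      by (simp add: divide_le_eq add_nonneg_pos)
  qed simp
  show "\<forall>\<^sub>F k in sequentially. - (real k * (real k - 1) / 2) / ((real k - 1)^2 + 1)
      - real k * (2 * (real k / ((real k - 1)^2 + 1))^2)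
    \<le> (\<Sum>i<k. ln (1 - real i / real ((k - 1)^2 + 1)))"
    using eventually_ge_at_top[of 2]
  proof eventually_elim
    case (elim k)
    define n where "n = (real k - 1)^2 + 1"
    have n: "n > 0" by (simp add: n_def add_nonneg_pos)
    have "- (real k * (real k - 1) / 2) / n - real k * (2 * (real k / n)^2)
        = (\<Sum>i<k. - (real i / n) - 2 * (real k / n)^2)"
      by (simp add: sum_subtractf sum_negf sum_divide_distrib[symmetric] sum_i)
    also have "\<dots> \<le> (\<Sum>i<k. ln (1 - real i / n))"
    proof (rule sum_mono)
      fix i assume "i \<in> {..<k}"
      then have i: "i < k" by simp
      have "(real i / n)^2 \<le> (real k / n)^2"
        using i n by (intro power_mono divide_right_mono) auto
      then have "- (real i / n) - 2 * (real k / n)^2 \<le> - (real i / n) - 2 * (real i / n)^2" by simp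
      also have "\<dots> \<le> ln (1 - real i / n)"
        using half[OF i] unfolding n_def by (intro ln_one_minus_pos_lower_bound) auto
      finally show "- (real i / n) - 2 * (real k / n)^2 \<le> ln (1 - real i / n)" .
    qed
    finally show ?case unfolding N[OF elim] n_def .
  qed
  show "\<forall>\<^sub>F k in sequentially. (\<Sum>i<k. ln (1 - real i / real ((k - 1)^2 + 1)))
    \<le> - (real k * (real k - 1) / 2) / ((real k - 1)^2 + 1)"
    using eventually_ge_at_top[of 2]
  proof eventually_elim
    case (elim k)
    define n where "n = (real k - 1)^2 + 1"
    have "(\<Sum>i<k. ln (1 - real i / n)) \<le> (\<Sum>i<k. - (real i / n))"
    proof (rule sum_mono)
      fix i assume "i \<in> {..<k}"
      then have "real i / n \<le> 1 / 2" using half[of i k] by (simp add: n_def)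
      then have "0 < 1 - real i / n" by linarith
      then show "ln (1 - real i / n) \<le> - (real i / n)"
        using ln_le_minus_one[of "1 - real i / n"] by simp
    qed
    also have "\<dots> = - (real k * (real k - 1) / 2) / n"
      by (simp add: sum_negf sum_divide_distrib[symmetric] sum_i)
    finally show ?case unfolding N[OF elim] n_def .
  qed
  show "(\<lambda>k. - (real k * (real k - 1) / 2) / ((real k - 1)^2 + 1)
      - real k * (2 * (real k / ((real k - 1)^2 + 1))^2)) \<longlonglongrightarrow> - 1 / 2"
    by real_asymp
  show "(\<lambda>k. - (real k * (real k - 1) / 2) / ((real k - 1)^2 + 1)) \<longlonglongrightarrow> - 1 / 2"
    by real_asymp
qed

definition choose_error :: "nat \<Rightarrow> real" where
  "choose_error k = ln (real (((k - 1)^2 + 1) choose k))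
    - ((real k - 1 / 2) * ln (real k) + real k - 5 / 2 - ln (2 * pi) / 2)"

lemma le_pred_square_Suc: "k \<le> (k - 1)^2 + 1" for k :: nat
  by (cases k; cases "k - 1") (auto simp: power2_eq_square)

text \<open>Write the coefficient as a falling product divided by \<open>fact k\<close>. With
  \<open>N = (k - 1)^2 + 1\<close>, the factor \<open>(N / k^2) ^ k\<close> contributes
  \<open>- 2\<close> to the logarithm, the factors \<open>1 - i / N\<close> contribute
  \<open>- 1 / 2\<close>, and Stirling's formula supplies \<open>ln (2 * pi) / 2\<close>.\<close>

lemma choose_error_tendsto: "choose_error \<longlonglongrightarrow> 0"
proof -
  have eq: "choose_error k = real k * (ln ((real k - 1)^2 + 1) - 2 * ln (real k))
      + (\<Sum>i<k. ln (1 - real i / real ((k - 1)^2 + 1))) - stirling_error k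
      + 5 / 2 + ln (2 * pi) / 2" if k: "k \<ge> 2" for k
  proof -
    define N where "N = (k - 1)^2 + 1"
    have kN: "k \<le> N" unfolding N_def by (rule le_pred_square_Suc)
    have NR: "real N = (real k - 1)^2 + 1" using k by (simp add: N_def of_nat_diff)
    have "real (N choose k) = (\<Prod>i<k. real (N - i)) / fact k"
      using binomial_altdef_of_nat[OF kN, where ?'a = real]
      unfolding binomial_gbinomial gbinomial_prod_rev atLeast0LessThan
      using kN by (auto intro!: prod.cong simp: of_nat_diff)
    then have "ln (real (N choose k)) = ln (\<Prod>i<k. real (N - i)) - ln (fact k)"
      using kN by (simp add: ln_div prod_pos)
    also have "ln (\<Prod>i<k. real (N - i)) = (\<Sum>i<k. ln (real (N - i)))"
      using kN by (subst ln_prod) auto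
    also have "\<dots> = (\<Sum>i<k. ln (real N) + ln (1 - real i / real N))"
    proof (rule sum.cong)
      fix i assume "i \<in> {..<k}"
      then have "i < N" using kN by simp
      then have "real (N - i) = real N * (1 - real i / real N)" "1 - real i / real N > 0" "real N > 0"
        by (auto simp: of_nat_diff field_simps)
      then show "ln (real (N - i)) = ln (real N) + ln (1 - real i / real N)"
        by (simp add: ln_mult)
    qed simp
    also have "\<dots> = real k * ln (real N) + (\<Sum>i<k. ln (1 - real i / real N))"
      by (simp add: sum.distrib)
    finally show ?thesis
      unfolding choose_error_def stirling_error_def N_def[symmetric] NR[symmetric]
      by (simp add: algebra_simps)
  qed
  have "(\<lambda>k. real k * (ln ((real k - 1)^2 + 1) - 2 * ln (real k))) \<longlonglongrightarrow> - 2"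
    by real_asymp
  then have "(\<lambda>k. real k * (ln ((real k - 1)^2 + 1) - 2 * ln (real k))
      + (\<Sum>i<k. ln (1 - real i / real ((k - 1)^2 + 1))) - stirling_error k
      + 5 / 2 + ln (2 * pi) / 2) \<longlonglongrightarrow> - 2 + (- 1 / 2) - ln (2 * pi) / 2 + 5 / 2 + ln (2 * pi) / 2"
    by (intro tendsto_add[OF tendsto_add[OF tendsto_diff[OF tendsto_add] tendsto_const] tendsto_const]
        sum_ln_one_minus_tendsto stirling_error_tendsto)
  moreover have "\<forall>\<^sub>F k in sequentially. choose_error k =
      real k * (ln ((real k - 1)^2 + 1) - 2 * ln (real k))
      + (\<Sum>i<k. ln (1 - real i / real ((k - 1)^2 + 1))) - stirling_error k
      + 5 / 2 + ln (2 * pi) / 2"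
    using eventually_ge_at_top[of 2] by eventually_elim (rule eq)
  ultimately have "choose_error \<longlonglongrightarrow> - 2 + (- 1 / 2) - ln (2 * pi) / 2 + 5 / 2 + ln (2 * pi) / 2"
    by (simp only: tendsto_cong)
  then show ?thesis by simp
qed

lemma choose_eq:
  assumes "k \<ge> 2"
  shows "real (((k - 1)^2 + 1) choose k) =
    real k powr (real k - 1 / 2) * exp (real k - 5 / 2) / sqrt (2 * pi) * exp (choose_error k)"
proof -
  have "real (((k - 1)^2 + 1) choose k) > 0"
    using le_pred_square_Suc[of k] by simp
  then have "real (((k - 1)^2 + 1) choose k) = exp (ln (real (((k - 1)^2 + 1) choose k)))" by simp
  also have "ln (real (((k - 1)^2 + 1) choose k)) = (real k - 1 / 2) * ln (real k)
      + (real k - 5 / 2) - ln (2 * pi) / 2 + choose_error k"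
    by (simp add: choose_error_def)
  also have "exp \<dots> = exp ((real k - 1 / 2) * ln (real k)) * exp (real k - 5 / 2)
      / exp (ln (2 * pi) / 2) * exp (choose_error k)"
    by (simp only: exp_add exp_diff)
  also have "exp (ln (2 * pi) / 2) = sqrt (2 * pi)"
    by (subst ln_sqrt[symmetric]) simp_all
  also have "exp ((real k - 1 / 2) * ln (real k)) = real k powr (real k - 1 / 2)"
    using assms by (simp add: powr_def)
  finally show ?thesis .
qed

text \<open>The squared \<open>sqrt (2 * pi)\<close> turns 16 into \<open>8 / pi\<close>, and the
  exponent \<open>2 * k - 1\<close> uses up one of the eight powers of \<open>k\<close>. The
  identity is exact: the last factor carries the whole relative error.\<close>

lemma edge_bound_eq:
  assumes "k \<ge> 2"
  shows "16 * real k ^ 8 * ln (real k) ^ 2 * real (((k - 1)^2 + 1) choose k) ^ 2 =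
    8 * real k ^ (2 * k + 7) * exp 1 ^ (2 * k) * ln (real k) ^ 2 / (pi * exp 1 ^ 5)
      * exp (choose_error k) ^ 2"
proof -
  have k: "real k > 0" using assms by simp
  have "(real k powr (real k - 1 / 2)) ^ 2 = real k powr (real (2 * k) - 1)"
    using k by (simp add: powr_power algebra_simps)
  also have "\<dots> = real k ^ (2 * k) / real k"
    using k by (simp only: powr_diff powr_realpow powr_one)
  finally have 1: "(real k powr (real k - 1 / 2)) ^ 2 = real k ^ (2 * k) / real k" .
  have "exp (real k - 5 / 2) ^ 2 = exp (real (2 * k) * 1 - real 5 * 1)"
    by (simp add: exp_double[symmetric] algebra_simps)
  also have "\<dots> = exp 1 ^ (2 * k) / exp 1 ^ 5" by (simp only: exp_diff exp_of_nat_mult)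
  finally have 2: "exp (real k - 5 / 2) ^ 2 = exp 1 ^ (2 * k) / exp 1 ^ 5" .
  have "real k ^ 8 = real k ^ 7 * real k" by (simp add: eval_nat_numeral)
  then show ?thesis
    unfolding choose_eq[OF assms] power_mult_distrib power_divide 1 2
    using k by (simp add: power_add field_simps)
qed

lemma vertex_bound_eq:
  assumes "k \<ge> 2"
  shows "4 * real k ^ 7 * ln (real k) * real (((k - 1)^2 + 1) choose k) =
    2 * sqrt 2 * real k powr (real k + 13 / 2) * exp 1 ^ k * ln (real k) / (sqrt pi * exp (5 / 2))
      * exp (choose_error k)"
proof -
  have k: "real k > 0" using assms by simp
  have "real k + 13 / 2 = real 7 + (real k - 1 / 2)" by simp
  then have 1: "real k powr (real k + 13 / 2) = real k ^ 7 * real k powr (real k - 1 / 2)"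
    using k by (simp only: powr_add powr_realpow)
  have "exp (real k - 5 / 2) = exp (real k * 1) / exp (5 / 2)" by (simp add: exp_diff)
  also have "\<dots> = exp 1 ^ k / exp (5 / 2)" by (simp only: exp_of_nat_mult)
  finally have 2: "exp (real k - 5 / 2) = exp 1 ^ k / exp (5 / 2)" .
  have 3: "sqrt (2 * pi) = sqrt 2 * sqrt pi" by (simp add: real_sqrt_mult)
  show ?thesis
    unfolding choose_eq[OF assms] 1 2 3 by (simp add: field_simps)
qed

section \<open>The number of slopes for large k\<close>

text \<open>As \<open>ln (N choose k)\<close> is about \<open>k * ln k\<close>, the left side is
  about \<open>2 k^3 ln k (N choose k)\<close>, half of \<open>S k\<close>. The other factor of 2
  absorbs the lower-order terms.\<close>

lemma eventually_block_number:
  defines "S \<equiv> (\<lambda>k. 4 * real k ^ 3 * ln (real k) * real (((k - 1)^2 + 1) choose k))"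
  shows "\<forall>\<^sub>F k in sequentially.
    2 * real ((k - 1)^2 + 1) * real (((k - 1)^2 + 1) choose k)
      * ln (real (((k - 1)^2 + 1)^2 * nat \<lfloor>S k\<rfloor>)) < real (nat \<lfloor>S k\<rfloor>)"
proof -
  have "\<forall>\<^sub>F k in sequentially. choose_error k < 1"
    using choose_error_tendsto by (rule order_tendstoD) simp
  \<comment> \<open>The required inequality divided by the binomial coefficient; the summand 1 pays
    for rounding \<open>S k\<close> down.\<close>
  moreover have "\<forall>\<^sub>F k in sequentially. 2 * real k ^ 2 * (7 * ln (real k) + ln 4 + ln (ln (real k))
      + ((real k - 1 / 2) * ln (real k) + real k)) + 1 < 4 * real k ^ 3 * ln (real k)"
    by real_asymp
  moreover have "\<forall>\<^sub>F k in sequentially. ln (real k) > 1" by real_asymp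
  moreover have "\<forall>\<^sub>F k in sequentially. k \<ge> (2::nat)" by (rule eventually_ge_at_top)
  ultimately show ?thesis
  proof eventually_elim
    case (elim k)
    define N where "N = (k - 1)^2 + 1"
    define B where "B = real (N choose k)"
    define L where "L = ln (real k)"
    define s where "s = nat \<lfloor>S k\<rfloor>"
    define Q where "Q = 7 * L + ln 4 + ln L + ((real k - 1 / 2) * L + real k)"
    have L: "L > 1" using elim by (simp add: L_def)
    have B: "B \<ge> 1" using le_pred_square_Suc[of k] by (simp add: B_def N_def Suc_le_eq)
    have SkB: "S k = 4 * real k ^ 3 * L * B" by (simp add: S_def L_def B_def N_def)
    have "real N = (real k - 1)^2 + 1" using elim by (simp add: N_def of_nat_diff)
    also have "\<dots> \<le> real k ^ 2" using elim by (simp add: power2_eq_square algebra_simps)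
    finally have N: "real N \<le> real k ^ 2" .
    have N1: "real N \<ge> 1" by (simp add: N_def)
    have k1: "real k ^ 3 \<ge> 1" using elim by (intro one_le_power) auto
    have "S k \<ge> 1"
    proof -
      have "1 * 1 * 1 * 1 \<le> 4 * real k ^ 3 * L * B"
        using k1 L B by (intro mult_mono) auto
      then show ?thesis by (simp add: SkB)
    qed
    then have s: "real s \<le> S k" "real s \<ge> 1" "real s > S k - 1"
      by (simp_all add: s_def)
    have lnB: "ln B \<le> (real k - 1 / 2) * L + real k"
    proof -
      have "ln (2 * pi) > 0" using pi_gt3 by (intro ln_gt_zero) auto
      moreover have "ln B = (real k - 1 / 2) * L + real k - 5 / 2 - ln (2 * pi) / 2 + choose_error k"
        by (simp add: choose_error_def B_def L_def N_def)
      ultimately show ?thesis using elim by linarith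
    qed
    have "real (N^2 * s) \<le> (real k ^ 2) ^ 2 * S k"
      unfolding of_nat_mult of_nat_power using N N1 s by (intro mult_mono power_mono) auto
    also have "\<dots> = 4 * real k ^ 7 * L * B" by (simp add: SkB eval_nat_numeral)
    finally have "ln (real (N^2 * s)) \<le> ln (4 * real k ^ 7 * L * B)"
      using N1 s by (intro ln_mono) auto
    also have "\<dots> = ln 4 + 7 * L + ln L + ln B"
      using L B elim by (simp add: ln_mult ln_realpow L_def)
    also have "\<dots> \<le> Q" using lnB by (simp add: Q_def)
    finally have lnQ: "ln (real (N^2 * s)) \<le> Q" .
    have "ln (real (N^2 * s)) \<ge> 0"
      using N1 s mult_mono[of 1 "real N ^ 2" 1 "real s"] by (intro ln_ge_zero) simp
    then have "2 * real N * B * ln (real (N^2 * s)) \<le> 2 * real k ^ 2 * B * Q"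
      using N lnQ B N1 by (intro mult_mono) auto
    also have "\<dots> = 2 * real k ^ 2 * Q * B" by simp
    also have "\<dots> < (4 * real k ^ 3 * L - 1) * B"
      using elim B unfolding Q_def L_def by (intro mult_strict_right_mono) auto
    also have "\<dots> = S k - B" by (simp add: SkB algebra_simps)
    also have "\<dots> \<le> S k - 1" using B by simp
    also have "\<dots> < real s" by (rule s)
    finally show ?case unfolding N_def B_def s_def .
  qed
qed

section \<open>The extremal numbers\<close>

text \<open>A linear function outgrows a logarithm, so some \<open>s\<close> works for each fixed
  \<open>k\<close>. The lower bounds rely on this for all \<open>k \<ge> 2\<close>: an infimum over
  the empty set would be 0.\<close>

lemma exists_linear_strong_ES:
  assumes k: "k \<ge> 2"
  shows "\<exists>(V :: nat set) \<E>. linear_kgraph k V \<E> \<and> strong_ES V \<E>"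
proof -
  define N where "N = (k - 1)^2 + 1"
  define c where "c = 2 * real N * real (N choose k)"
  have "N > 0" by (simp add: N_def)
  then have "real N ^ 2 > 0" by simp
  moreover have "k \<le> N" unfolding N_def by (rule le_pred_square_Suc)
  then have "c > 0" using \<open>N > 0\<close> by (simp add: c_def)
  ultimately have "\<forall>\<^sub>F s in sequentially. c * ln (real N ^ 2 * real s) < real s"
    by real_asymp
  then obtain s where "c * ln (real N ^ 2 * real s) < real s"
    by (auto simp: eventually_sequentially)
  then have "2 * real N * real (N choose k) * ln (real (N^2 * s)) < real s" by (simp add: c_def)
  then show ?thesis
    using exists_strong_ES[OF k, of s] unfolding N_def by blast
qed

text \<open>The weak property asserts the existence of a linear order; any enumeration of the finite
  set \<open>V\<close> provides one.\<close>

lemma strong_ES_imp_weak_ES: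
  assumes "linear_kgraph k V \<E>" "strong_ES V \<E>"
  shows "weak_ES V \<E>"
proof -
  have "finite V" using assms(1) by (simp add: linear_kgraph_def kgraph_def)
  then obtain xs where "set xs = V" "distinct xs" using finite_distinct_list by blast
  then have "linear_order_on V (list_order xs)" using linear_order_list_order by blast
  then show ?thesis using assms(2) unfolding weak_ES_def strong_ES_def by blast
qed

lemma f_sES_attained:
  assumes "k \<ge> 2"
  obtains V :: "nat set" and \<E> where "linear_kgraph k V \<E>" "strong_ES V \<E>" "f_sES k = card \<E>"
proof -
  have "f_sES k \<in> {card \<E> |(V :: nat set) \<E>. linear_kgraph k V \<E> \<and> strong_ES V \<E>}"
    unfolding f_sES_def using exists_linear_strong_ES[OF assms] by (intro Inf_nat_def1) blast
  then show ?thesis using that by blast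
qed

lemma n_sES_attained:
  assumes "k \<ge> 2"
  obtains V :: "nat set" and \<E> where "linear_kgraph k V \<E>" "strong_ES V \<E>" "n_sES k = card V"
proof -
  have "n_sES k \<in> {card V |(V :: nat set) \<E>. linear_kgraph k V \<E> \<and> strong_ES V \<E>}"
    unfolding n_sES_def using exists_linear_strong_ES[OF assms] by (intro Inf_nat_def1) blast
  then show ?thesis using that by blast
qed

lemma exists_linear_weak_ES:
  assumes k: "k \<ge> 2"
  shows "\<exists>(V :: nat set) \<E>. linear_kgraph k V \<E> \<and> weak_ES V \<E>"
proof -
  obtain V :: "nat set" and \<E> where "linear_kgraph k V \<E>" "strong_ES V \<E>"
    using exists_linear_strong_ES[OF k] by blast
  then show ?thesis using strong_ES_imp_weak_ES by blast
qed

lemma f_wES_attained: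
  assumes "k \<ge> 2"
  obtains V :: "nat set" and \<E> where "linear_kgraph k V \<E>" "weak_ES V \<E>" "f_wES k = card \<E>"
proof -
  have "f_wES k \<in> {card \<E> |(V :: nat set) \<E>. linear_kgraph k V \<E> \<and> weak_ES V \<E>}"
    unfolding f_wES_def using exists_linear_weak_ES[OF assms] by (intro Inf_nat_def1) blast
  then show ?thesis using that by blast
qed

lemma n_wES_attained:
  assumes "k \<ge> 2"
  obtains V :: "nat set" and \<E> where "linear_kgraph k V \<E>" "weak_ES V \<E>" "n_wES k = card V"
proof -
  have "n_wES k \<in> {card V |(V :: nat set) \<E>. linear_kgraph k V \<E> \<and> weak_ES V \<E>}"
    unfolding n_wES_def using exists_linear_weak_ES[OF assms] by (intro Inf_nat_def1) blast
  then show ?thesis using that by blast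
qed

lemma f_wES_le_f_sES: "k \<ge> 2 \<Longrightarrow> f_wES k \<le> f_sES k"
proof -
  assume "k \<ge> 2"
  then obtain V :: "nat set" and \<E>
    where E: "linear_kgraph k V \<E>" "strong_ES V \<E>" "f_sES k = card \<E>"
    by (rule f_sES_attained)
  then have "weak_ES V \<E>" by (intro strong_ES_imp_weak_ES)
  then show ?thesis unfolding f_wES_def E(3) using E(1) by (intro cInf_lower) blast+
qed

lemma n_wES_le_n_sES: "k \<ge> 2 \<Longrightarrow> n_wES k \<le> n_sES k"
proof -
  assume "k \<ge> 2"
  then obtain V :: "nat set" and \<E>
    where E: "linear_kgraph k V \<E>" "strong_ES V \<E>" "n_sES k = card V"
    by (rule n_sES_attained)
  then have "weak_ES V \<E>" by (intro strong_ES_imp_weak_ES)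
  then show ?thesis unfolding n_wES_def E(3) using E(1) by (intro cInf_lower) blast+
qed

text \<open>Uses \<open>s = \<lfloor>S\<rfloor>\<close> slopes. Since \<open>N \<le> k^2\<close>,
  there are at most \<open>k^2 * S^2\<close> edges and \<open>k^4 * S\<close> vertices, which are
  the stated bounds.\<close>

lemma eventually_sES_le:
  "\<forall>\<^sub>F k in sequentially.
    real (f_sES k) \<le> 16 * real k ^ 8 * ln (real k) ^ 2 * real (((k - 1)^2 + 1) choose k) ^ 2 \<and>
    real (n_sES k) \<le> 4 * real k ^ 7 * ln (real k) * real (((k - 1)^2 + 1) choose k)"
  using eventually_block_number eventually_ge_at_top[of 2]
proof eventually_elim
  case (elim k)
  define N where "N = (k - 1)^2 + 1"
  define S where "S = 4 * real k ^ 3 * ln (real k) * real (N choose k)"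
  define s where "s = nat \<lfloor>S\<rfloor>"
  have "2 * real N * real (N choose k) * ln (real (N^2 * s)) < real s"
    using elim(1) unfolding N_def S_def s_def .
  then obtain V :: "nat set" and \<E> where E: "linear_kgraph k V \<E>" "strong_ES V \<E>"
    "card V = N^2 * s" "card \<E> \<le> N * s^2"
    using exists_strong_ES[OF elim(2), of s] unfolding N_def by blast
  have "S \<ge> 0" using elim by (simp add: S_def)
  then have s: "real s \<le> S" by (simp add: s_def)
  have "real N = (real k - 1)^2 + 1" using elim by (simp add: N_def of_nat_diff)
  also have "\<dots> \<le> real k ^ 2" using elim by (simp add: power2_eq_square algebra_simps)
  finally have N: "real N \<le> real k ^ 2" .
  have "f_sES k \<le> card \<E>" unfolding f_sES_def using E by (intro cInf_lower) auto
  then have "real (f_sES k) \<le> real (N * s^2)" using E(4) by linarith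
  also have "\<dots> \<le> real k ^ 2 * S ^ 2"
    unfolding of_nat_mult of_nat_power using N s by (intro mult_mono power_mono) auto
  also have "\<dots> = 16 * real k ^ 8 * ln (real k) ^ 2 * real (N choose k) ^ 2"
    by (simp add: S_def power_mult_distrib flip: power_mult power_add)
  finally have f: "real (f_sES k) \<le> 16 * real k ^ 8 * ln (real k) ^ 2 * real (N choose k) ^ 2" .
  have "n_sES k \<le> card V" unfolding n_sES_def using E(1,2) by (intro cInf_lower) blast+
  then have "real (n_sES k) \<le> real (N^2 * s)" unfolding E(3) by (rule of_nat_mono)
  also have "\<dots> \<le> (real k ^ 2) ^ 2 * S"
    unfolding of_nat_mult of_nat_power using N s by (intro mult_mono power_mono) auto
  also have "\<dots> = 4 * real k ^ 7 * ln (real k) * real (N choose k)"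
    by (simp add: S_def flip: power_mult power_add)
  finally have "real (n_sES k) \<le> 4 * real k ^ 7 * ln (real k) * real (N choose k)" .
  with f show ?case unfolding N_def by blast
qed

text \<open>Turns an eventual inequality into one with a factor \<open>1 + o(1)\<close> valid from
  \<open>m\<close> on: finitely many exceptions fit into \<epsilon>, and \<delta> additionally
  absorbs \<open>exp (\<theta> k)\<close>.\<close>

lemma asymptotic_upper_bound:
  fixes f X Y \<theta> :: "nat \<Rightarrow> real"
  assumes le: "\<forall>\<^sub>F k in sequentially. f k \<le> X k"
    and pos: "\<And>k. k \<ge> m \<Longrightarrow> X k > 0"
    and eq: "\<And>k. k \<ge> m \<Longrightarrow> X k = Y k * exp (\<theta> k)" and \<theta>: "\<theta> \<longlonglongrightarrow> 0"
  shows "\<exists>\<epsilon> \<delta> :: nat \<Rightarrow> real. \<epsilon> \<longlonglongrightarrow> 0 \<and> \<delta> \<longlonglongrightarrow> 0 \<and>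
    (\<forall>k\<ge>m. f k \<le> (1 + \<epsilon> k) * X k \<and> (1 + \<epsilon> k) * X k = (1 + \<delta> k) * Y k)"
proof -
  define \<epsilon> where "\<epsilon> = (\<lambda>k. max 0 (f k / X k - 1))"
  define \<delta> where "\<delta> = (\<lambda>k. (1 + \<epsilon> k) * exp (\<theta> k) - 1)"
  have "\<forall>\<^sub>F k in sequentially. \<epsilon> k = 0"
    using le eventually_ge_at_top[of m]
  proof eventually_elim
    case (elim k)
    then show ?case using pos[of k] by (simp add: \<epsilon>_def)
  qed
  then have \<epsilon>: "\<epsilon> \<longlonglongrightarrow> 0" by (rule tendsto_eventually)
  have "(\<lambda>k. (1 + \<epsilon> k) * exp (\<theta> k) - 1) \<longlonglongrightarrow> (1 + 0) * exp 0 - 1"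
    by (intro tendsto_intros \<epsilon> \<theta>)
  then have \<delta>: "\<delta> \<longlonglongrightarrow> 0" by (simp add: \<delta>_def)
  have "f k \<le> (1 + \<epsilon> k) * X k \<and> (1 + \<epsilon> k) * X k = (1 + \<delta> k) * Y k" if k: "k \<ge> m" for k
  proof
    have "f k = f k / X k * X k" using pos[OF k] by simp
    also have "\<dots> \<le> (1 + \<epsilon> k) * X k"
      using pos[OF k] by (intro mult_right_mono) (auto simp: \<epsilon>_def)
    finally show "f k \<le> (1 + \<epsilon> k) * X k" .
    show "(1 + \<epsilon> k) * X k = (1 + \<delta> k) * Y k" by (simp add: eq[OF k] \<delta>_def)
  qed
  with \<epsilon> \<delta> show ?thesis by blast
qed

theorem theorem1p9:
  shows "(\<forall>k\<ge>2. (fact k :: real)^2 / (8 * exp 1 ^ 2 * real k ^ 4) \<le> real (f_wES k) \<and>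
                 f_wES k \<le> f_sES k)
    \<and> (\<exists>\<epsilon> \<delta> :: nat \<Rightarrow> real. \<epsilon> \<longlonglongrightarrow> 0 \<and> \<delta> \<longlonglongrightarrow> 0 \<and>
        (\<forall>k\<ge>2.
          real (f_sES k)
            \<le> (1 + \<epsilon> k) * (16 * real k ^ 8 * ln (real k) ^ 2 * real (((k - 1)^2 + 1) choose k) ^ 2) \<and>
          (1 + \<epsilon> k) * (16 * real k ^ 8 * ln (real k) ^ 2 * real (((k - 1)^2 + 1) choose k) ^ 2)
            = (1 + \<delta> k) * (8 * real k ^ (2 * k + 7) * exp 1 ^ (2 * k) * ln (real k) ^ 2
                           / (pi * exp 1 ^ 5))))
    \<and> (\<forall>k\<ge>2. (real k - 1) * fact (k - 1) / (2 * exp 1 * real k) \<le> real (n_wES k) \<and>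
              n_wES k \<le> n_sES k)
    \<and> (\<exists>\<epsilon> \<delta> :: nat \<Rightarrow> real. \<epsilon> \<longlonglongrightarrow> 0 \<and> \<delta> \<longlonglongrightarrow> 0 \<and>
        (\<forall>k\<ge>2.
          real (n_sES k)
            \<le> (1 + \<epsilon> k) * (4 * real k ^ 7 * ln (real k) * real (((k - 1)^2 + 1) choose k)) \<and>
          (1 + \<epsilon> k) * (4 * real k ^ 7 * ln (real k) * real (((k - 1)^2 + 1) choose k))
            = (1 + \<delta> k) * (2 * sqrt 2 * real k powr (real k + 13 / 2) * exp 1 ^ k * ln (real k)
                           / (sqrt pi * exp (5 / 2)))))"
proof (intro conjI allI impI)
  fix k :: nat assume k: "k \<ge> 2"
  obtain V :: "nat set" and \<E>
    where "linear_kgraph k V \<E>" "weak_ES V \<E>" "f_wES k = card \<E>"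
    using f_wES_attained[OF k] .
  then show "(fact k :: real)^2 / (8 * exp 1 ^ 2 * real k ^ 4) \<le> real (f_wES k)"
    using weak_ES_card_edges_ge'[OF k] by simp
  show "f_wES k \<le> f_sES k" by (rule f_wES_le_f_sES[OF k])
next
  fix k :: nat assume k: "k \<ge> 2"
  obtain V :: "nat set" and \<E>
    where V: "linear_kgraph k V \<E>" "weak_ES V \<E>" "n_wES k = card V"
    using n_wES_attained[OF k] .
  have "(real k - 1) * fact (k - 1) / (2 * exp 1 * real k)
      = (real k - 1) * fact (k - 1) / (2 * exp 1) / real k"
    by simp
  \<comment> \<open>Here the surplus factor \<open>k\<close> of the vertex bound is given
    away.\<close>
  also have "\<dots> \<le> (real k - 1) * fact (k - 1) / (2 * exp 1) / 1"
    using k by (intro divide_left_mono) auto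
  also have "\<dots> \<le> real (n_wES k)"
    using weak_ES_card_vertices_ge[OF k V(1,2)] V(3) by simp
  finally show "(real k - 1) * fact (k - 1) / (2 * exp 1 * real k) \<le> real (n_wES k)" .
  show "n_wES k \<le> n_sES k" by (rule n_wES_le_n_sES[OF k])
next
  \<comment> \<open>Squaring the binomial coefficient doubles its logarithmic error.\<close>
  have "(\<lambda>k. 2 * choose_error k) \<longlonglongrightarrow> 2 * 0"
    by (intro tendsto_intros choose_error_tendsto)
  then have \<theta>: "(\<lambda>k. 2 * choose_error k) \<longlonglongrightarrow> 0" by simp
  show "\<exists>\<epsilon> \<delta> :: nat \<Rightarrow> real. \<epsilon> \<longlonglongrightarrow> 0 \<and> \<delta> \<longlonglongrightarrow> 0 \<and>
        (\<forall>k\<ge>2.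
          real (f_sES k)
            \<le> (1 + \<epsilon> k) * (16 * real k ^ 8 * ln (real k) ^ 2 * real (((k - 1)^2 + 1) choose k) ^ 2) \<and>
          (1 + \<epsilon> k) * (16 * real k ^ 8 * ln (real k) ^ 2 * real (((k - 1)^2 + 1) choose k) ^ 2)
            = (1 + \<delta> k) * (8 * real k ^ (2 * k + 7) * exp 1 ^ (2 * k) * ln (real k) ^ 2
                           / (pi * exp 1 ^ 5)))"
  proof (rule asymptotic_upper_bound[OF _ _ _ \<theta>])
    show "\<forall>\<^sub>F k in sequentially. real (f_sES k)
        \<le> 16 * real k ^ 8 * ln (real k) ^ 2 * real (((k - 1)^2 + 1) choose k) ^ 2"
      using eventually_sES_le by eventually_elim simp
    show "16 * real k ^ 8 * ln (real k) ^ 2 * real (((k - 1)^2 + 1) choose k) ^ 2 > 0"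
      if "k \<ge> 2" for k
      using that le_pred_square_Suc[of k] by simp
    show "16 * real k ^ 8 * ln (real k) ^ 2 * real (((k - 1)^2 + 1) choose k) ^ 2
        = 8 * real k ^ (2 * k + 7) * exp 1 ^ (2 * k) * ln (real k) ^ 2 / (pi * exp 1 ^ 5)
          * exp (2 * choose_error k)" if "k \<ge> 2" for k
      unfolding exp_double by (rule edge_bound_eq[OF that])
  qed
  show "\<exists>\<epsilon> \<delta> :: nat \<Rightarrow> real. \<epsilon> \<longlonglongrightarrow> 0 \<and> \<delta> \<longlonglongrightarrow> 0 \<and>
        (\<forall>k\<ge>2.
          real (n_sES k)
            \<le> (1 + \<epsilon> k) * (4 * real k ^ 7 * ln (real k) * real (((k - 1)^2 + 1) choose k)) \<and>
          (1 + \<epsilon> k) * (4 * real k ^ 7 * ln (real k) * real (((k - 1)^2 + 1) choose k))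
            = (1 + \<delta> k) * (2 * sqrt 2 * real k powr (real k + 13 / 2) * exp 1 ^ k * ln (real k)
                           / (sqrt pi * exp (5 / 2))))"
  proof (rule asymptotic_upper_bound[OF _ _ _ choose_error_tendsto])
    show "\<forall>\<^sub>F k in sequentially. real (n_sES k)
        \<le> 4 * real k ^ 7 * ln (real k) * real (((k - 1)^2 + 1) choose k)"
      using eventually_sES_le by eventually_elim simp
    show "4 * real k ^ 7 * ln (real k) * real (((k - 1)^2 + 1) choose k) > 0" if "k \<ge> 2" for k
      using that le_pred_square_Suc[of k] by simp
  qed (rule vertex_bound_eq)
qed

end
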